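(* Let $\mathcal{S}_3$ be the algebra of polynomial functions on the space $M_3^0(\mathbb{C})$ of traceless complex $3\times 3$ matrices that are invariant under the conjugation action $x\mapsto axa^{-1}$ of $\mathrm{SO}_3(\mathbb{C})$. Then $\mathcal{S}_3$ has the following presentation as a $\mathbb{C}$-algebra: $$\mathcal{S}_3\cong \mathbb{C}[t_1,\ldots,t_6]/(t_6^2+c_1t_6+c_2),$$ where $t_1,\ldots,t_6$ are six independent commuting variables and $c_1,c_2\in\mathbb{C}[t_1,\ldots,t_5]$ are given by $$3c_1 = t_3^2-3t_2t_5-3t_4^2,$$ $$\begin{aligned}144c_2 ={}& 72t_1^4t_5+144t_5(t_1t_3t_4+t_5^2)+16t_3^2(t_2^3+t_3^2)\\ &+24t_1^2t_2t_3(t_3+t_4)-3t_1(t_1^2+t_2^2)(16t_3t_4+3t_1^3)\\ &+36t_1^2(t_1t_4^2+t_2^2t_5-5t_5^2)+96t_3t_4^2(t_4-t_3)\\ &+144t_4^2t_5(t_2-t_1)-4t_3^2(t_1^3+24t_2t_5).\end{aligned}$$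
   Context: $\mathrm{SO}_3(\mathbb{C})=\{a\in M_3(\mathbb{C}): aa'=I_3,\ \det a=1\}$, where $a'$ denotes the transpose. The variables $t_1,\ldots,t_6$ correspond to the invariants $E_1=\operatorname{tr}(x^2)$, $E_2=\operatorname{tr}(xx')$, $E_3=\operatorname{tr}(x^3)$, $E_4=\operatorname{tr}(x^2x')$, $E_5=\operatorname{tr}(x^2(x')^2)$, $E_6=\operatorname{tr}(xx'x^2(x')^2)$ of $x\in M_3^0(\mathbb{C})$, respectively. *)

theory Defs
  imports
    "HOL-Analysis.Analysis"
    "HOL-Algebra.Algebra"
    "HOL-Algebra.Algebraic_Closure_Type"
    "HOL-Library.Poly_Mapping"
    "HOL-Library.Numeral_Type"
begin

text \<open>
  Multivariate polynomials over \<open>\<complex>\<close> in variables indexed by \<open>'v\<close>: finitely supported maps from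
  monomials (exponent vectors) to coefficients. The product of \<^typ>\<open>'a \<Rightarrow>\<^sub>0 'b\<close> is convolution,
  hence the usual product of polynomials.
\<close>

type_synonym 'v cpoly = "('v \<Rightarrow>\<^sub>0 nat) \<Rightarrow>\<^sub>0 complex"

definition Const :: "complex \<Rightarrow> 'v cpoly" where
  "Const c = Poly_Mapping.single 0 c"

definition Var :: "'v \<Rightarrow> 'v cpoly" where
  "Var i = Poly_Mapping.single (Poly_Mapping.single i 1) 1"

definition cpoly_eval :: "('v::finite \<Rightarrow> complex) \<Rightarrow> 'v cpoly \<Rightarrow> complex" where
  "cpoly_eval a p =
     (\<Sum>m\<in>Poly_Mapping.keys p. Poly_Mapping.lookup p m * (\<Prod>i\<in>UNIV. a i ^ Poly_Mapping.lookup m i))"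

type_synonym cmat3 = "complex^3^3"

definition SO3 :: "cmat3 set" where
  "SO3 = {a. a ** transpose a = mat 1 \<and> det a = 1}"

definition M30 :: "cmat3 set" where
  "M30 = {x. trace x = 0}"

text \<open>
  Functions on \<open>M30\<close> are represented by total functions that are \<^const>\<open>undefined\<close> outside \<open>M30\<close>,
  so that equality of representatives is equality of functions on \<open>M30\<close>. Polynomial functions on
  the subspace \<open>M30\<close> are the restrictions of polynomials in the nine matrix entries.
\<close>

definition poly_funs :: "(cmat3 \<Rightarrow> complex) set" where
  "poly_funs = {f \<in> extensional M30.
     \<exists>p :: (3 \<times> 3) cpoly. \<forall>x\<in>M30. f x = cpoly_eval (\<lambda>(i, j). x $ i $ j) p}"

definition S3 :: "(cmat3 \<Rightarrow> complex) ring" where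
  "S3 = \<lparr>carrier = {f \<in> poly_funs. \<forall>a\<in>SO3. \<forall>x\<in>M30. f (a ** x ** matrix_inv a) = f x},
         monoid.mult = (\<lambda>f g. \<lambda>x\<in>M30. f x * g x),
         monoid.one = (\<lambda>x\<in>M30. 1),
         ring.zero = (\<lambda>x\<in>M30. 0),
         ring.add = (\<lambda>f g. \<lambda>x\<in>M30. f x + g x)\<rparr>"

definition E1 :: "cmat3 \<Rightarrow> complex" where
  "E1 = (\<lambda>x\<in>M30. trace (x ** x))"

definition E2 :: "cmat3 \<Rightarrow> complex" where
  "E2 = (\<lambda>x\<in>M30. trace (x ** transpose x))"

definition E3 :: "cmat3 \<Rightarrow> complex" where
  "E3 = (\<lambda>x\<in>M30. trace (x ** x ** x))"

definition E4 :: "cmat3 \<Rightarrow> complex" where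
  "E4 = (\<lambda>x\<in>M30. trace (x ** x ** transpose x))"

definition E5 :: "cmat3 \<Rightarrow> complex" where
  "E5 = (\<lambda>x\<in>M30. trace (x ** x ** transpose x ** transpose x))"

definition E6 :: "cmat3 \<Rightarrow> complex" where
  "E6 = (\<lambda>x\<in>M30. trace (x ** transpose x ** x ** x ** transpose x ** transpose x))"

text \<open>
  The variables \<open>t\<^sub>1, \<dots>, t\<^sub>6\<close> are indexed by the six-element type \<^typ>\<open>6\<close>, whose elements are
  \<open>1, \<dots>, 6\<close> with arithmetic modulo 6 (so \<open>6 = 0\<close>).
\<close>

abbreviation t1 :: "6 cpoly" where "t1 \<equiv> Var 1"
abbreviation t2 :: "6 cpoly" where "t2 \<equiv> Var 2"
abbreviation t3 :: "6 cpoly" where "t3 \<equiv> Var 3"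
abbreviation t4 :: "6 cpoly" where "t4 \<equiv> Var 4"
abbreviation t5 :: "6 cpoly" where "t5 \<equiv> Var 5"
abbreviation t6 :: "6 cpoly" where "t6 \<equiv> Var 6"

definition c1 :: "6 cpoly" where
  "c1 = Const (1/3) * (t3^2 - 3 * t2 * t5 - 3 * t4^2)"

definition c2 :: "6 cpoly" where
  "c2 = Const (1/144) *
    (72 * t1^4 * t5 + 144 * t5 * (t1 * t3 * t4 + t5^2) + 16 * t3^2 * (t2^3 + t3^2)
     + 24 * t1^2 * t2 * t3 * (t3 + t4) - 3 * t1 * (t1^2 + t2^2) * (16 * t3 * t4 + 3 * t1^3)
     + 36 * t1^2 * (t1 * t4^2 + t2^2 * t5 - 5 * t5^2) + 96 * t3 * t4^2 * (t4 - t3)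
     + 144 * t4^2 * t5 * (t2 - t1) - 4 * t3^2 * (t1^3 + 24 * t2 * t5))"

lemma three_c1: "3 * c1 = t3^2 - 3 * t2 * t5 - 3 * t4^2"
proof -
  have *: "3 * Const (1/3) = (1 :: 6 cpoly)"
    unfolding Const_def single_numeral[symmetric] mult_single by simp
  then show ?thesis
    unfolding c1_def by (simp only: mult.assoc[symmetric, of _ "Const _"] * mult_1)
qed

lemma c2_times_144:
  "144 * c2 =
     72 * t1^4 * t5 + 144 * t5 * (t1 * t3 * t4 + t5^2) + 16 * t3^2 * (t2^3 + t3^2)
     + 24 * t1^2 * t2 * t3 * (t3 + t4) - 3 * t1 * (t1^2 + t2^2) * (16 * t3 * t4 + 3 * t1^3)
     + 36 * t1^2 * (t1 * t4^2 + t2^2 * t5 - 5 * t5^2) + 96 * t3 * t4^2 * (t4 - t3)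
     + 144 * t4^2 * t5 * (t2 - t1) - 4 * t3^2 * (t1^3 + 24 * t2 * t5)"
proof -
  have *: "144 * Const (1/144) = (1 :: 6 cpoly)"
    unfolding Const_def single_numeral[symmetric] mult_single by simp
  then show ?thesis
    unfolding c2_def by (simp only: mult.assoc[symmetric, of _ "Const _"] * mult_1)
qed

definition Ct :: "6 cpoly ring" where
  "Ct = ring_of_type_algebra"

definition relation_ideal :: "6 cpoly set" where
  "relation_ideal = PIdl\<^bsub>Ct\<^esub> (t6^2 + c1 * t6 + c2)"

definition quot_class :: "6 cpoly \<Rightarrow> 6 cpoly set" where
  "quot_class p = relation_ideal +>\<^bsub>Ct\<^esub> p"

end

theory Submission
  imports Defs
begin

text \<open>
  Write a traceless matrix as \<open>x = s + a\<close> with \<open>s\<close> symmetric and traceless and \<open>a\<close> antisymmetric;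
  \<open>a\<close> is the cross product with a vector \<open>v\<close>, and a rotation \<open>g\<close> acts by
  \<open>s \<mapsto> g s g\<^sup>T\<close>, \<open>v \<mapsto> g v\<close>. The obvious invariants are \<open>p2 = tr s\<^sup>2\<close>, \<open>p3 = tr s\<^sup>3\<close>, the moments
  \<open>q0 = v \<cdot> v\<close>, \<open>q1 = v \<cdot> s v\<close>, \<open>q2 = s v \<cdot> s v\<close>, and the volume \<open>d = det (v, s v, s\<^sup>2 v)\<close>.
  By Cayley-Hamilton the Gram determinant \<open>d\<^sup>2\<close> is a polynomial \<open>D\<close> in \<open>p2, p3, q0, q1, q2\<close>
  (\<open>vol_squared\<close>). The invariants \<open>E1, ..., E5\<close> arise from \<open>p2, p3, q0, q1, q2\<close> by an invertible
  polynomial change of coordinates, and \<open>E6 - 8 d\<close> is a polynomial in \<open>E1, ..., E5\<close>; rewriting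
  \<open>d\<^sup>2 = D\<close> in terms of \<open>E1, ..., E6\<close> gives the relation \<open>t\<^sub>6\<^sup>2 + c\<^sub>1 t\<^sub>6 + c\<^sub>2 = 0\<close>. So it must be shown
  that the invariants form a free module with basis \<open>1, d\<close> over \<open>\<complex>[p2, p3, q0, q1, q2]\<close>, and that
  these five functions are algebraically independent.

  Spanning (\<open>inv_span_invariant\<close>). Put \<open>H = q0 q2 - q1\<^sup>2\<close>. If \<open>H \<noteq> 0\<close>, then \<open>v, s v, v \<times> s v\<close> is a
  basis in which both the bilinear form and \<open>x\<close> have matrices that depend on the six basic invariants
  only; hence these invariants separate the orbits with \<open>H \<noteq> 0\<close> (\<open>invariants_separate\<close>). An explicit
  slice meets each orbit with \<open>q0 H \<noteq> 0\<close> in points whose coordinates are polynomials in the basic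
  invariants and a square root of \<open>q0\<close>, divided by powers of \<open>q0\<close> and \<open>H\<close>. Evaluating an invariant \<open>f\<close>
  there and averaging over the two square roots yields \<open>(q0 H)\<^sup>n f = A + d B\<close> with polynomials \<open>A, B\<close> in
  \<open>p2, p3, q0, q1, q2\<close>. The factors \<open>q0\<close> and \<open>H\<close> are then cancelled one by one. If \<open>q0 f = A + d B\<close>, then
  the right-hand side vanishes wherever \<open>q0\<close> does. Transposing \<open>x\<close> changes the sign of \<open>d\<close> and fixes the
  other five, so \<open>A\<close> and \<open>D B\<close> vanish there. The points with \<open>q0 = 0\<close> realise all
  \<open>p2, p3, q1, q2\<close> with \<open>q1 \<noteq> 0\<close> (\<open>isotropic_slice_exists\<close>) and \<open>q0\<close> does not divide \<open>D\<close>, so \<open>q0\<close>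
  divides \<open>A\<close> and \<open>B\<close>. For \<open>H\<close>, which is linear in \<open>q2\<close> with leading coefficient \<open>q0\<close>, pseudo-division gives the same up to a power of \<open>q0\<close>, which is
  cancelled as before.

  Independence (\<open>inv_span_zero\<close>). The slice realises all \<open>p2, p3, q0, q1, q2\<close> with \<open>q0 H \<noteq> 0\<close>; together
  with the sign change under transposition, \<open>A + d B = 0\<close> forces \<open>A = B = 0\<close>.
\<close>

text \<open>The notation \<open>$\<close> for coefficients of power series is withdrawn: it makes matrix entries ambiguous.\<close>

no_notation fps_nth (infixl \<open>$\<close> 75)

section \<open>Polynomials and their evaluation\<close>

text \<open>
  The value of a monomial, given by its exponents.
\<close>

abbreviation mon :: "('v::finite \<Rightarrow> complex) \<Rightarrow> ('v \<Rightarrow>\<^sub>0 nat) \<Rightarrow> complex" where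
  "mon a m \<equiv> (\<Prod>i\<in>UNIV. a i ^ Poly_Mapping.lookup m i)"

lemma cpoly_eval_superset:
  assumes "finite S" "Poly_Mapping.keys p \<subseteq> S"
  shows "cpoly_eval a p = (\<Sum>m\<in>S. Poly_Mapping.lookup p m * mon a m)"
  unfolding cpoly_eval_def
  by (rule sum.mono_neutral_left) (use assms in \<open>auto simp: in_keys_iff\<close>)

lemma cpoly_eval_add: "cpoly_eval a (p + q) = cpoly_eval a p + cpoly_eval a q"
proof -
  let ?S = "Poly_Mapping.keys p \<union> Poly_Mapping.keys q"
  have "cpoly_eval a (p + q) = (\<Sum>m\<in>?S. Poly_Mapping.lookup (p + q) m * mon a m)"
    by (rule cpoly_eval_superset) (auto dest: subsetD[OF Poly_Mapping.keys_add])
  also have "\<dots> = (\<Sum>m\<in>?S. Poly_Mapping.lookup p m * mon a m)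
      + (\<Sum>m\<in>?S. Poly_Mapping.lookup q m * mon a m)"
    by (simp add: lookup_add algebra_simps sum.distrib)
  also have "\<dots> = cpoly_eval a p + cpoly_eval a q"
    by (simp add: cpoly_eval_superset[of ?S])
  finally show ?thesis .
qed

lemma cpoly_eval_single: "cpoly_eval a (Poly_Mapping.single m c) = c * mon a m"
  by (subst cpoly_eval_superset[of "{m}"]) auto

lemma cpoly_eval_0 [simp]: "cpoly_eval a 0 = 0"
  by (simp add: cpoly_eval_def)

lemma cpoly_eval_Const [simp]: "cpoly_eval a (Const c) = c"
  by (simp add: Const_def cpoly_eval_single)

lemma cpoly_eval_Var [simp]: "cpoly_eval a (Var i) = a i"
proof -
  have "mon a (Poly_Mapping.single i 1) = (\<Prod>j\<in>UNIV. if j = i then a i else 1)"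
    by (rule prod.cong) (auto simp: lookup_single when_def)
  then show ?thesis
    by (simp add: Var_def cpoly_eval_single)
qed

text \<open>
  A polynomial is a finite sum of terms, so additive properties need only be checked on terms.
\<close>

lemma cpoly_single_induct [case_names single add]:
  fixes p :: "'v cpoly"
  assumes single: "\<And>m c. P (Poly_Mapping.single m c)"
    and add: "\<And>p q. P p \<Longrightarrow> P q \<Longrightarrow> P (p + q)"
  shows "P p"
proof (induction p rule: Poly_Mapping.update_induct)
  case const
  show ?case using single[of 0 0] by simp
next
  case (update f a b)
  have "Poly_Mapping.update a b f = Poly_Mapping.single a b + f"
    using update by (intro poly_mapping_eqI)
      (auto simp: lookup_update lookup_add lookup_single in_keys_iff when_def)
  then show ?case using add[OF single update(3)] by simp
qed

lemma cpoly_eval_mult [simp]: "cpoly_eval a (p * q) = cpoly_eval a p * cpoly_eval a q"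
proof (induction p rule: cpoly_single_induct)
  case (single m c)
  show ?case
  proof (induction q rule: cpoly_single_induct)
    case (single n d)
    show ?case
      by (simp add: mult_single cpoly_eval_single lookup_add power_add prod.distrib)
  next
    case (add p q)
    then show ?case by (simp add: distrib_left cpoly_eval_add)
  qed
next
  case (add p q)
  then show ?case by (simp add: distrib_right cpoly_eval_add)
qed

declare cpoly_eval_add [simp]

lemma cpoly_eval_1 [simp]: "cpoly_eval a 1 = 1"
  using cpoly_eval_Const[of a 1] by (simp add: Const_def)

lemma cpoly_eval_power [simp]: "cpoly_eval a (p ^ n) = cpoly_eval a p ^ n"
  by (induction n) auto

lemma cpoly_eval_uminus [simp]: "cpoly_eval a (- p) = - cpoly_eval a p"
proof -
  have "cpoly_eval a (- p) + cpoly_eval a p = 0"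
    by (simp flip: cpoly_eval_add)
  then show ?thesis by (simp add: eq_neg_iff_add_eq_0)
qed

lemma cpoly_eval_diff [simp]: "cpoly_eval a (p - q) = cpoly_eval a p - cpoly_eval a q"
  using cpoly_eval_add[of a p "- q"] by simp

lemma cpoly_eval_numeral [simp]: "cpoly_eval a (numeral n) = numeral n"
  using cpoly_eval_Const[of a "numeral n"] by (simp add: Const_def)

lemma cpoly_single_in_closure:
  fixes m :: "'v \<Rightarrow>\<^sub>0 nat"
  assumes Const: "\<And>c. P (Const c)" and Var: "\<And>i. P (Var i)"
    and mult: "\<And>p q. P p \<Longrightarrow> P q \<Longrightarrow> P (p * q)"
  shows "P (Poly_Mapping.single m c)"
proof -
  have pow: "P (Poly_Mapping.single (Poly_Mapping.single i n) 1)" for i n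
  proof (induction n)
    case 0
    show ?case using Const[of 1] by (simp add: Const_def)
  next
    case (Suc n)
    have "P (Var i * Poly_Mapping.single (Poly_Mapping.single i n) 1)"
      by (rule mult[OF Var Suc])
    then show ?case by (simp add: Var_def mult_single flip: single_add)
  qed
  have "P (Poly_Mapping.single m 1)"
  proof (induction m rule: Poly_Mapping.update_induct)
    case const
    show ?case using Const[of 1] by (simp add: Const_def)
  next
    case (update f a b)
    have "Poly_Mapping.update a b f = Poly_Mapping.single a b + f"
      using update by (intro poly_mapping_eqI)
        (auto simp: lookup_update lookup_add lookup_single in_keys_iff when_def)
    then show ?case using mult[OF pow[of a b] update(3)] by (simp add: mult_single)
  qed
  from mult[OF Const[of c] this] show ?thesis by (simp add: Const_def mult_single)
qed

text \<open>
  The polynomials are generated by constants and variables under addition and multiplication.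
\<close>

lemma cpoly_induct [case_names Const Var add mult]:
  fixes p :: "'v cpoly"
  assumes "\<And>c. P (Const c)" and "\<And>i. P (Var i)"
    and "\<And>p q. P p \<Longrightarrow> P q \<Longrightarrow> P (p + q)"
    and "\<And>p q. P p \<Longrightarrow> P q \<Longrightarrow> P (p * q)"
  shows "P p"
  by (rule cpoly_single_induct) (use assms in \<open>auto intro: cpoly_single_in_closure\<close>)

lemma mon_scale: "mon (a(i := c * a i)) m = c ^ Poly_Mapping.lookup m i * mon a m"
proof -
  have "mon (a(i := c * a i)) m
      = (\<Prod>j\<in>UNIV. (if j = i then c ^ Poly_Mapping.lookup m i else 1) * a j ^ Poly_Mapping.lookup m j)"
    by (rule prod.cong) (auto simp: power_mult_distrib)
  then show ?thesis by (simp add: prod.distrib)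
qed

text \<open>
  Monomials are pairwise distinct multiplicative characters, hence linearly independent as functions:
  scaling a coordinate in which two exponents differ eliminates one of the two monomials.
\<close>

lemma monomials_independent:
  assumes "finite K" "\<And>a. (\<Sum>m\<in>K. c m * mon a m) = 0" "m \<in> K"
  shows "c m = 0"
  using assms
proof (induction K arbitrary: c m rule: finite_induct)
  case (insert m0 K)
  have *: "c m = 0" if "m \<in> K" for m
  proof -
    from that insert.hyps have "m \<noteq> m0" by auto
    then obtain i where i: "Poly_Mapping.lookup m i \<noteq> Poly_Mapping.lookup m0 i"
      by (meson poly_mapping_eqI)
    have "c m * (2 ^ Poly_Mapping.lookup m i - 2 ^ Poly_Mapping.lookup m0 i) = 0"
    proof (rule insert.IH[OF _ that])
      fix a :: "'a \<Rightarrow> complex"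
      have "0 = (\<Sum>m\<in>insert m0 K. c m * mon (a(i := 2 * a i)) m)
          - 2 ^ Poly_Mapping.lookup m0 i * (\<Sum>m\<in>insert m0 K. c m * mon a m)"
        by (simp only: insert.prems mult_zero_right diff_zero)
      also have "\<dots> = (\<Sum>m\<in>insert m0 K.
          c m * (2 ^ Poly_Mapping.lookup m i - 2 ^ Poly_Mapping.lookup m0 i) * mon a m)"
        unfolding mon_scale by (simp add: sum_distrib_left algebra_simps flip: sum_subtractf)
      also have "\<dots> = (\<Sum>m\<in>K.
          c m * (2 ^ Poly_Mapping.lookup m i - 2 ^ Poly_Mapping.lookup m0 i) * mon a m)"
        using insert.hyps by simp
      finally show "(\<Sum>m\<in>K.
          c m * (2 ^ Poly_Mapping.lookup m i - 2 ^ Poly_Mapping.lookup m0 i) * mon a m) = 0" ..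
    qed
    moreover have "(2::complex) ^ Poly_Mapping.lookup m i \<noteq> 2 ^ Poly_Mapping.lookup m0 i"
    proof
      assume "(2::complex) ^ Poly_Mapping.lookup m i = 2 ^ Poly_Mapping.lookup m0 i"
      then have "norm ((2::complex) ^ Poly_Mapping.lookup m i) = norm ((2::complex) ^ Poly_Mapping.lookup m0 i)"
        by simp
      with i show False by (simp add: norm_power)
    qed
    ultimately show ?thesis by simp
  qed
  have "c m0 = 0"
    using insert.prems(1)[of "\<lambda>_. 1"] insert.hyps * by simp
  with * insert.prems(2) show ?case by auto
qed simp

lemma cpoly_eval_injective:
  assumes "\<And>a. cpoly_eval a p = 0"
  shows "p = 0"
proof (rule poly_mapping_eqI)
  fix m
  show "Poly_Mapping.lookup p m = Poly_Mapping.lookup 0 m"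
    using monomials_independent[of "Poly_Mapping.keys p" "Poly_Mapping.lookup p" m] assms
    by (cases "m \<in> Poly_Mapping.keys p") (auto simp: cpoly_eval_def in_keys_iff)
qed

text \<open>
  Along an affine line, a polynomial in several variables is a polynomial in the parameter.
\<close>

lemma cpoly_eval_line: "\<exists>r. \<forall>t. cpoly_eval (\<lambda>i. a i + t * (b i - a i)) p = poly r t"
proof (induction p rule: cpoly_induct)
  case (Const c)
  show ?case by (rule exI[of _ "[:c:]"]) simp
next
  case (Var i)
  show ?case by (rule exI[of _ "[:a i, b i - a i:]"]) simp
next
  case (add p q)
  then obtain r s where "\<forall>t. cpoly_eval (\<lambda>i. a i + t * (b i - a i)) p = poly r t"
    "\<forall>t. cpoly_eval (\<lambda>i. a i + t * (b i - a i)) q = poly s t" by blast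
  then show ?case by (intro exI[of _ "r + s"]) simp
next
  case (mult p q)
  then obtain r s where "\<forall>t. cpoly_eval (\<lambda>i. a i + t * (b i - a i)) p = poly r t"
    "\<forall>t. cpoly_eval (\<lambda>i. a i + t * (b i - a i)) q = poly s t" by blast
  then show ?case by (intro exI[of _ "r * s"]) simp
qed

text \<open>
  The functions given by polynomials on a set that contains the line through any two of its points
  form an integral domain: restrict to the line that joins a point where one factor is nonzero to a
  point where the other one is.
\<close>

lemma cpoly_eval_no_zero_divisors:
  assumes V: "\<And>a b t. a \<in> V \<Longrightarrow> b \<in> V \<Longrightarrow> (\<lambda>i. a i + t * (b i - a i)) \<in> V"
    and zero: "\<And>a. a \<in> V \<Longrightarrow> cpoly_eval a p * cpoly_eval a q = 0"
    and p: "a \<in> V" "cpoly_eval a p \<noteq> 0" and b: "b \<in> V"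
  shows "cpoly_eval b q = 0"
proof (rule ccontr)
  assume q: "cpoly_eval b q \<noteq> 0"
  obtain r where r: "\<And>t. cpoly_eval (\<lambda>i. a i + t * (b i - a i)) p = poly r t"
    using cpoly_eval_line by blast
  obtain s where s: "\<And>t. cpoly_eval (\<lambda>i. a i + t * (b i - a i)) q = poly s t"
    using cpoly_eval_line by blast
  have "poly (r * s) t = 0" for t
    using zero[OF V[OF p(1) b, of t]] r s by simp
  then have "r * s = 0" using poly_all_0_iff_0 by blast
  then have "r = 0 \<or> s = 0" by simp
  moreover have "poly r 0 \<noteq> 0" using r[of 0] p by simp
  moreover have "poly s 1 \<noteq> 0" using s[of 1] q by simp
  ultimately show False by (metis poly_0)
qed

lemma cpoly_subst:
  fixes p :: "'v::finite cpoly" and s :: "'v \<Rightarrow> 'w::finite cpoly"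
  obtains q where "\<And>a. cpoly_eval a q = cpoly_eval (\<lambda>i. cpoly_eval a (s i)) p"
proof -
  have "\<exists>q. \<forall>a. cpoly_eval a q = cpoly_eval (\<lambda>i. cpoly_eval a (s i)) p"
  proof (induction p rule: cpoly_induct)
    case (Const c)
    show ?case by (rule exI[of _ "Const c"]) simp
  next
    case (Var i)
    show ?case by (rule exI[of _ "s i"]) simp
  next
    case (add p q)
    then obtain p' q' where "\<forall>a. cpoly_eval a p' = cpoly_eval (\<lambda>i. cpoly_eval a (s i)) p"
      "\<forall>a. cpoly_eval a q' = cpoly_eval (\<lambda>i. cpoly_eval a (s i)) q" by blast
    then show ?case by (intro exI[of _ "p' + q'"]) simp
  next
    case (mult p q)
    then obtain p' q' where "\<forall>a. cpoly_eval a p' = cpoly_eval (\<lambda>i. cpoly_eval a (s i)) p"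
      "\<forall>a. cpoly_eval a q' = cpoly_eval (\<lambda>i. cpoly_eval a (s i)) q" by blast
    then show ?case by (intro exI[of _ "p' * q'"]) simp
  qed
  with that show thesis by blast
qed

section \<open>Symmetric and axial parts of a traceless matrix\<close>

text \<open>
  The symmetric part \<open>s\<close> of a matrix, and the vector \<open>v\<close> for which the antisymmetric part is the
  map \<open>w \<mapsto> v \<times> w\<close>.
\<close>

definition sympart :: "cmat3 \<Rightarrow> cmat3" where
  "sympart x = (\<chi> i j. (x $ i $ j + x $ j $ i) / 2)"

definition axial :: "cmat3 \<Rightarrow> complex^3" where
  "axial x = vector [(x $ 3 $ 2 - x $ 2 $ 3) / 2, (x $ 1 $ 3 - x $ 3 $ 1) / 2, (x $ 2 $ 1 - x $ 1 $ 2) / 2]"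

text \<open>
  The complex bilinear (not Hermitian) dot product, and the cross product.
\<close>

definition dotc :: "complex^3 \<Rightarrow> complex^3 \<Rightarrow> complex" where
  "dotc u v = u $ 1 * v $ 1 + u $ 2 * v $ 2 + u $ 3 * v $ 3"

definition crossc :: "complex^3 \<Rightarrow> complex^3 \<Rightarrow> complex^3" where
  "crossc u v = vector [u $ 2 * v $ 3 - u $ 3 * v $ 2, u $ 3 * v $ 1 - u $ 1 * v $ 3, u $ 1 * v $ 2 - u $ 2 * v $ 1]"

text \<open>
  The basic invariants: \<open>tr2\<close> and \<open>tr3\<close> are \<open>tr s\<^sup>2\<close> and \<open>tr s\<^sup>3\<close>; the vectors \<open>krylov1\<close> and \<open>krylov2\<close> are
  \<open>s v\<close> and \<open>s\<^sup>2 v\<close>; the moments \<open>mom0\<close>, \<open>mom1\<close>, \<open>mom2\<close> are \<open>v \<cdot> v\<close>, \<open>v \<cdot> s v\<close>, \<open>s v \<cdot> s v\<close>; and \<open>vol\<close> is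
  \<open>det (v, s v, s\<^sup>2 v)\<close>.
\<close>

definition tr2 :: "cmat3 \<Rightarrow> complex" where
  "tr2 x = trace (sympart x ** sympart x)"

definition tr3 :: "cmat3 \<Rightarrow> complex" where
  "tr3 x = trace (sympart x ** sympart x ** sympart x)"

definition krylov1 :: "cmat3 \<Rightarrow> complex^3" where "krylov1 x = sympart x *v axial x"
definition krylov2 :: "cmat3 \<Rightarrow> complex^3" where "krylov2 x = sympart x *v krylov1 x"

definition mom0 :: "cmat3 \<Rightarrow> complex" where "mom0 x = dotc (axial x) (axial x)"
definition mom1 :: "cmat3 \<Rightarrow> complex" where "mom1 x = dotc (axial x) (krylov1 x)"
definition mom2 :: "cmat3 \<Rightarrow> complex" where "mom2 x = dotc (krylov1 x) (krylov1 x)"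
definition vol :: "cmat3 \<Rightarrow> complex" where
  "vol x = dotc (crossc (axial x) (krylov1 x)) (krylov2 x)"

text \<open>
  Linear coordinates on the traceless matrices: \<open>a, b, c, d, e\<close> are entries of the symmetric part,
  whose last diagonal entry is \<open>-(a + d)\<close>, and \<open>v1, v2, v3\<close> are the entries of the axial vector.
\<close>

definition gen :: "complex \<Rightarrow> complex \<Rightarrow> complex \<Rightarrow> complex \<Rightarrow> complex \<Rightarrow> complex \<Rightarrow> complex \<Rightarrow> complex \<Rightarrow> cmat3" where
  "gen a b c d e v1 v2 v3 = vector [vector [a, b - v3, c + v2], vector [b + v3, d, e - v1], vector [c - v2, e + v1, - (a + d)]]"

lemma gen_in_M30 [simp]: "gen a b c d e v1 v2 v3 \<in> M30"
  by (simp add: M30_def gen_def trace_def sum_3)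

lemma M30_gen:
  assumes "x \<in> M30"
  obtains a b c d e v1 v2 v3 where "x = gen a b c d e v1 v2 v3"
proof
  have "x $ 1 $ 1 + x $ 2 $ 2 + x $ 3 $ 3 = 0"
    using assms by (simp add: M30_def trace_def sum_3)
  then have x33: "x $ 3 $ 3 = - (x $ 1 $ 1 + x $ 2 $ 2)"
    by (rule add_eq_0_iff[THEN iffD1])
  show "x = gen (x $ 1 $ 1) ((x $ 1 $ 2 + x $ 2 $ 1) / 2) ((x $ 1 $ 3 + x $ 3 $ 1) / 2) (x $ 2 $ 2)
     ((x $ 2 $ 3 + x $ 3 $ 2) / 2) ((x $ 3 $ 2 - x $ 2 $ 3) / 2) ((x $ 1 $ 3 - x $ 3 $ 1) / 2) ((x $ 2 $ 1 - x $ 1 $ 2) / 2)"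
    using x33 by (simp add: gen_def vec_eq_iff forall_3 diff_divide_distrib[symmetric] add_divide_distrib[symmetric])
qed

lemma sympart_gen: "sympart (gen a b c d e v1 v2 v3) = vector [vector [a, b, c], vector [b, d, e], vector [c, e, - (a + d)]]"
  by (simp add: sympart_def gen_def vec_eq_iff forall_3)

lemma axial_gen: "axial (gen a b c d e v1 v2 v3) = vector [v1, v2, v3]"
  by (simp add: axial_def gen_def)

lemmas mat_simps = matrix_matrix_mult_def matrix_vector_mult_def trace_def transpose_def sum_3 dotc_def crossc_def

lemma tr2_gen: "tr2 (gen a b c d e v1 v2 v3) = 2 * (a * a + d * d + a * d + b * b + c * c + e * e)"
  unfolding tr2_def sympart_gen by (simp add: mat_simps) Groebner_Basis.algebra

lemma tr3_gen: "tr3 (gen a b c d e v1 v2 v3)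
    = 3 * (2 * b * c * e - a * d * (a + d) - a * e * e - d * c * c + (a + d) * b * b)"
  unfolding tr3_def sympart_gen by (simp add: mat_simps) Groebner_Basis.algebra

lemma krylov1_gen: "krylov1 (gen a b c d e v1 v2 v3) =
   vector [a * v1 + b * v2 + c * v3, b * v1 + d * v2 + e * v3, c * v1 + e * v2 - (a + d) * v3]"
  unfolding krylov1_def sympart_gen axial_gen by (simp add: mat_simps vec_eq_iff forall_3) (simp add: algebra_simps)

lemma krylov2_gen:
  fixes a b c d e v1 v2 v3 :: complex
  defines "w1 \<equiv> a * v1 + b * v2 + c * v3" and "w2 \<equiv> b * v1 + d * v2 + e * v3"
    and "w3 \<equiv> c * v1 + e * v2 - (a + d) * v3"
  shows "krylov2 (gen a b c d e v1 v2 v3) =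
   vector [a * w1 + b * w2 + c * w3, b * w1 + d * w2 + e * w3, c * w1 + e * w2 - (a + d) * w3]"
  unfolding krylov2_def krylov1_gen sympart_gen w1_def[symmetric] w2_def[symmetric] w3_def[symmetric]
  by (simp add: mat_simps vec_eq_iff forall_3) (simp add: algebra_simps)

lemma gen_entries:
  "gen a b c d e v1 v2 v3 $ 1 $ 1 = a" "gen a b c d e v1 v2 v3 $ 1 $ 2 = b - v3"
  "gen a b c d e v1 v2 v3 $ 1 $ 3 = c + v2" "gen a b c d e v1 v2 v3 $ 2 $ 1 = b + v3"
  "gen a b c d e v1 v2 v3 $ 2 $ 2 = d" "gen a b c d e v1 v2 v3 $ 2 $ 3 = e - v1"
  "gen a b c d e v1 v2 v3 $ 3 $ 1 = c - v2" "gen a b c d e v1 v2 v3 $ 3 $ 2 = e + v1"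
  "gen a b c d e v1 v2 v3 $ 3 $ 3 = - (a + d)"
  by (simp_all add: gen_def)

lemmas gen_simps = tr2_gen tr3_gen mom0_def mom1_def mom2_def vol_def axial_gen krylov1_gen krylov2_gen
  dotc_def crossc_def vector_3

lemmas trace_simps = mat_simps vec_lambda_beta gen_entries

text \<open>
  The six traces in terms of the basic invariants. Each equation is a polynomial identity in the
  eight coordinates.
\<close>

lemma E1_eq:
  assumes "x \<in> M30"
  shows "E1 x = tr2 x - 2 * mom0 x"
proof -
  obtain a b c d e v1 v2 v3 where x: "x = gen a b c d e v1 v2 v3" using M30_gen[OF assms] .
  have "trace (x ** x) = tr2 x - 2 * mom0 x"
    unfolding x gen_simps trace_simps by Groebner_Basis.algebra
  then show ?thesis using assms by (simp add: E1_def)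
qed

lemma E2_eq:
  assumes "x \<in> M30"
  shows "E2 x = tr2 x + 2 * mom0 x"
proof -
  obtain a b c d e v1 v2 v3 where x: "x = gen a b c d e v1 v2 v3" using M30_gen[OF assms] .
  have "trace (x ** transpose x) = tr2 x + 2 * mom0 x"
    unfolding x gen_simps trace_simps by Groebner_Basis.algebra
  then show ?thesis using assms by (simp add: E2_def)
qed

lemma E3_eq:
  assumes "x \<in> M30"
  shows "E3 x = tr3 x + 3 * mom1 x"
proof -
  obtain a b c d e v1 v2 v3 where x: "x = gen a b c d e v1 v2 v3" using M30_gen[OF assms] .
  have "trace (x ** x ** x) = tr3 x + 3 * mom1 x"
    unfolding x gen_simps trace_simps by Groebner_Basis.algebra
  then show ?thesis using assms by (simp add: E3_def)
qed

lemma E4_eq: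
  assumes "x \<in> M30"
  shows "E4 x = tr3 x - mom1 x"
proof -
  obtain a b c d e v1 v2 v3 where x: "x = gen a b c d e v1 v2 v3" using M30_gen[OF assms] .
  have "trace (x ** x ** transpose x) = tr3 x - mom1 x"
    unfolding x gen_simps trace_simps by Groebner_Basis.algebra
  then show ?thesis using assms by (simp add: E4_def)
qed

lemma E5_eq:
  assumes "x \<in> M30"
  shows "2 * E5 x = (tr2 x)\<^sup>2 + 4 * (mom0 x)\<^sup>2 + 8 * mom2 x - 4 * tr2 x * mom0 x"
proof -
  obtain a b c d e v1 v2 v3 where x: "x = gen a b c d e v1 v2 v3" using M30_gen[OF assms] .
  have "2 * trace (x ** x ** transpose x ** transpose x) = (tr2 x)\<^sup>2 + 4 * (mom0 x)\<^sup>2 + 8 * mom2 x - 4 * tr2 x * mom0 x"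
    unfolding x gen_simps trace_simps by Groebner_Basis.algebra
  then show ?thesis using assms by (simp add: E5_def)
qed

lemma E6_eq:
  assumes "x \<in> M30"
  shows "6 * E6 x = 48 * vol x - (E3 x)\<^sup>2 + 3 * E2 x * E5 x + 3 * (E4 x)\<^sup>2"
proof -
  obtain a b c d e v1 v2 v3 where x: "x = gen a b c d e v1 v2 v3" using M30_gen[OF assms] .
  \<comment> \<open>Bracketed so that the products of two matrices are expanded before they are combined.\<close>
  have "12 * trace ((x ** transpose x) ** ((x ** x) ** (transpose x ** transpose x)))
    = 96 * vol x - 2 * (tr3 x + 3 * mom1 x)\<^sup>2
    + 3 * (tr2 x + 2 * mom0 x) * ((tr2 x)\<^sup>2 + 4 * (mom0 x)\<^sup>2 + 8 * mom2 x - 4 * tr2 x * mom0 x)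
    + 6 * (tr3 x - mom1 x)\<^sup>2"
    unfolding x gen_simps trace_simps by Groebner_Basis.algebra
  then have "12 * E6 x = 96 * vol x - 2 * (E3 x)\<^sup>2 + 3 * E2 x * (2 * E5 x) + 6 * (E4 x)\<^sup>2"
    using assms by (simp add: E2_eq E3_eq E4_eq E5_eq E6_def matrix_mul_assoc)
  then have "2 * (6 * E6 x) = 2 * (48 * vol x - (E3 x)\<^sup>2 + 3 * E2 x * E5 x + 3 * (E4 x)\<^sup>2)"
    by (simp add: algebra_simps)
  then show ?thesis by (simp only: mult_cancel_left) simp
qed

section \<open>The basic invariants separate generic orbits\<close>

text \<open>
  The Gram determinant of \<open>v, s v, s\<^sup>2 v\<close>, that is, the Hankel determinant of the moments
  \<open>q0, ..., q4\<close>, where \<open>q3\<close> and \<open>q4\<close> are eliminated by Cayley-Hamilton,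
  \<open>s\<^sup>3 = (p2 / 2) s + p3 / 3\<close>.
\<close>

definition gram_det :: "complex \<Rightarrow> complex \<Rightarrow> complex \<Rightarrow> complex \<Rightarrow> complex \<Rightarrow> complex" where
  "gram_det p2 p3 q0 q1 q2 =
    (let q3 = p2 / 2 * q1 + p3 / 3 * q0; q4 = p2 / 2 * q2 + p3 / 3 * q1
     in q0 * (q2 * q4 - q3\<^sup>2) - q1 * (q1 * q4 - q2 * q3) + q2 * (q1 * q3 - q2\<^sup>2))"

lemma mom2_alt:
  assumes "x \<in> M30"
  shows "dotc (axial x) (krylov2 x) = mom2 x"
proof -
  obtain a b c d e v1 v2 v3 where x: "x = gen a b c d e v1 v2 v3" using M30_gen[OF assms] .
  show ?thesis unfolding x gen_simps by Groebner_Basis.algebra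
qed

lemma mom3_eq:
  assumes "x \<in> M30"
  shows "dotc (krylov1 x) (krylov2 x) = tr2 x / 2 * mom1 x + tr3 x / 3 * mom0 x"
proof -
  obtain a b c d e v1 v2 v3 where x: "x = gen a b c d e v1 v2 v3" using M30_gen[OF assms] .
  have "6 * dotc (krylov1 x) (krylov2 x) = 3 * tr2 x * mom1 x + 2 * tr3 x * mom0 x"
    unfolding x gen_simps by Groebner_Basis.algebra
  then show ?thesis by (simp add: field_simps)
qed

lemma mom4_eq:
  assumes "x \<in> M30"
  shows "dotc (krylov2 x) (krylov2 x) = tr2 x / 2 * mom2 x + tr3 x / 3 * mom1 x"
proof -
  obtain a b c d e v1 v2 v3 where x: "x = gen a b c d e v1 v2 v3" using M30_gen[OF assms] .
  have "6 * dotc (krylov2 x) (krylov2 x) = 3 * tr2 x * mom2 x + 2 * tr3 x * mom1 x"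
    unfolding x gen_simps by Groebner_Basis.algebra
  then show ?thesis by (simp add: field_simps)
qed

lemma gram_det_vectors:
  "(dotc (crossc u v) w)\<^sup>2 =
     dotc u u * (dotc v v * dotc w w - (dotc v w)\<^sup>2)
     - dotc u v * (dotc u v * dotc w w - dotc u w * dotc v w)
     + dotc u w * (dotc u v * dotc v w - dotc u w * dotc v v)"
  unfolding dotc_def crossc_def vector_3 by Groebner_Basis.algebra

lemma vol_squared:
  assumes "x \<in> M30"
  shows "(vol x)\<^sup>2 = gram_det (tr2 x) (tr3 x) (mom0 x) (mom1 x) (mom2 x)"
  unfolding vol_def gram_det_vectors gram_det_def Let_def mom3_eq[OF assms] mom4_eq[OF assms]
    mom2_alt[OF assms] mom0_def[symmetric] mom1_def[symmetric] mom2_def[symmetric]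
  by (simp add: power2_eq_square)

text \<open>
  The matrix with rows \<open>v\<close>, \<open>s v\<close>, \<open>v \<times> s v\<close>, and the Gram determinant \<open>H\<close> of \<open>v\<close> and \<open>s v\<close>, which is
  also the determinant of this matrix.
\<close>

definition frame :: "cmat3 \<Rightarrow> cmat3" where
  "frame x = vector [axial x, krylov1 x, crossc (axial x) (krylov1 x)]"

definition mom_det :: "cmat3 \<Rightarrow> complex" where
  "mom_det x = mom0 x * mom2 x - (mom1 x)\<^sup>2"

lemma frame_gram:
  "frame x ** transpose (frame x) =
    vector [vector [mom0 x, mom1 x, 0], vector [mom1 x, mom2 x, 0], vector [0, 0, mom_det x]]"
  unfolding vec_eq_iff forall_3 frame_def matrix_matrix_mult_def transpose_def vec_lambda_beta sum_3 vector_3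
    mom0_def mom1_def mom2_def mom_det_def dotc_def crossc_def
  by (intro conjI; (rule refl | Groebner_Basis.algebra))

text \<open>
  With \<open>mom3_eq\<close>, all entries are polynomials in the basic invariants. The last one uses that \<open>s\<close>
  is traceless.
\<close>

lemma frame_matrix:
  assumes "x \<in> M30"
  shows "frame x ** x ** transpose (frame x) =
    vector [vector [mom1 x, mom2 x, 0],
            vector [mom2 x, dotc (krylov1 x) (krylov2 x), vol x - mom_det x],
            vector [0, vol x + mom_det x, mom1 x * mom2 x - mom0 x * dotc (krylov1 x) (krylov2 x)]]"
proof -
  obtain a b c d e v1 v2 v3 where x: "x = gen a b c d e v1 v2 v3" using M30_gen[OF assms] .
  show ?thesis
    unfolding vec_eq_iff forall_3 frame_def matrix_matrix_mult_def transpose_def vec_lambda_beta sum_3 vector_3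
      mom_det_def x gen_simps gen_entries
    by (intro conjI; (rule refl | Groebner_Basis.algebra))
qed

lemma det_frame: "det (frame x) = mom_det x"
  unfolding det_3 frame_def vector_3 mom_det_def mom0_def mom1_def mom2_def dotc_def crossc_def
  by Groebner_Basis.algebra

text \<open>
  If the frames have equal Gram matrices, then the linear map that carries the one frame to the other
  is orthogonal, and it carries \<open>x\<close> to \<open>y\<close> if both have the same matrix in their frames.
\<close>

lemma invariants_separate:
  assumes x: "x \<in> M30" and y: "y \<in> M30"
    and eq: "tr2 x = tr2 y" "tr3 x = tr3 y" "mom0 x = mom0 y" "mom1 x = mom1 y" "mom2 x = mom2 y"
      "vol x = vol y"
    and nz: "mom_det x \<noteq> 0"
  obtains g where "g \<in> SO3" "y = g ** x ** transpose g"
proof -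
  define A where "A = transpose (frame x)"
  define B where "B = transpose (frame y)"
  have md: "mom_det x = mom_det y" using eq by (simp add: mom_det_def)
  have gram: "transpose A ** A = transpose B ** B"
    using frame_gram[of x] frame_gram[of y] eq md by (simp add: A_def B_def)
  have mat: "transpose A ** x ** A = transpose B ** y ** B"
    using frame_matrix[OF x] frame_matrix[OF y] eq md mom3_eq[OF x] mom3_eq[OF y]
    by (simp add: A_def B_def)
  have detA: "det A = mom_det x" and detB: "det B = mom_det x"
    using det_frame md by (simp_all add: A_def B_def)
  obtain A' where A': "A ** A' = mat 1" "A' ** A = mat 1"
    using nz detA invertible_det_nz[of A] unfolding invertible_def by auto
  have tA': "transpose A' ** transpose A = mat 1"
    using A'(1) by (metis matrix_transpose_mul transpose_mat)
  define g where "g = B ** A'"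
  have gA: "g ** A = B" using A' by (simp add: g_def matrix_mul_assoc[symmetric])
  have "transpose g ** g = transpose A' ** (transpose B ** B) ** A'"
    by (simp add: g_def matrix_transpose_mul matrix_mul_assoc)
  also have "\<dots> = (transpose A' ** transpose A) ** (A ** A')"
    by (simp add: gram[symmetric] matrix_mul_assoc)
  finally have tgg: "transpose g ** g = mat 1" using A' tA' by simp
  then have ggt: "g ** transpose g = mat 1" using matrix_left_right_inverse by blast
  have "det g * det A = det A" using gA detA detB by (metis det_mul)
  then have "det g = 1" using nz detA by simp
  with ggt have g: "g \<in> SO3" by (simp add: SO3_def)
  have "x = (transpose A' ** transpose A) ** x ** (A ** A')" using A' tA' by simp
  also have "\<dots> = transpose A' ** (transpose A ** x ** A) ** A'" by (simp add: matrix_mul_assoc)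
  also have "\<dots> = transpose g ** y ** g"
    unfolding mat by (simp add: g_def matrix_transpose_mul matrix_mul_assoc)
  finally have "g ** x ** transpose g = (g ** transpose g) ** y ** (g ** transpose g)"
    by (simp add: matrix_mul_assoc)
  with ggt have "y = g ** x ** transpose g" by simp
  with g that show thesis by blast
qed

lemma transpose_M30: "x \<in> M30 \<Longrightarrow> transpose x \<in> M30"
  by (simp add: M30_def trace_def transpose_def)

lemma sympart_transpose: "sympart (transpose x) = sympart x"
  by (simp add: sympart_def transpose_def add.commute)

lemma axial_transpose: "axial (transpose x) = - axial x"
  by (simp add: axial_def transpose_def vec_eq_iff forall_3 field_simps)

lemma krylov1_transpose: "krylov1 (transpose x) = - krylov1 x"
  by (simp add: krylov1_def sympart_transpose axial_transpose matrix_vector_mult_def vec_eq_iff sum_negf)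

lemma krylov2_transpose: "krylov2 (transpose x) = - krylov2 x"
  by (simp add: krylov2_def sympart_transpose krylov1_transpose matrix_vector_mult_def vec_eq_iff sum_negf)

lemma invariants_transpose:
  "tr2 (transpose x) = tr2 x" "tr3 (transpose x) = tr3 x" "mom0 (transpose x) = mom0 x"
  "mom1 (transpose x) = mom1 x" "mom2 (transpose x) = mom2 x" "vol (transpose x) = - vol x"
  by (simp_all add: tr2_def tr3_def mom0_def mom1_def mom2_def vol_def sympart_transpose axial_transpose
    krylov1_transpose krylov2_transpose dotc_def crossc_def)

section \<open>Slices\<close>

text \<open>
  Matrices with \<open>v = (a, 0, 0)\<close>. In the plane orthogonal to \<open>v\<close> the isotropic vectors
  \<open>e = (0, 1, \<i>)\<close> and \<open>f = (0, 1, -\<i>)\<close> are used; the slice is normalised by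
  \<open>s (1, 0, 0) = \<alpha> (1, 0, 0) + e + m f\<close>. Since \<open>s\<close> is symmetric and traceless, this leaves two free
  parameters \<open>y\<close> and \<open>z\<close>: \<open>s e = 2 m (1, 0, 0) - (\<alpha> / 2) e + 2 y f\<close> and
  \<open>s f = 2 (1, 0, 0) + 2 z e - (\<alpha> / 2) f\<close>. Where an orthonormal basis would require further square
  roots, this one requires only \<open>a\<close>, a square root of \<open>q0\<close>.
\<close>

definition slice :: "complex \<Rightarrow> complex \<Rightarrow> complex \<Rightarrow> complex \<Rightarrow> complex \<Rightarrow> cmat3" where
  "slice a \<alpha> m y z = gen \<alpha> (1 + m) (\<i> * (1 - m)) (y + z - \<alpha> / 2) (\<i> * (z - y)) a 0 0"

lemma slice_M30 [simp]: "slice a \<alpha> m y z \<in> M30"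
  by (simp add: slice_def)

lemma invariants_slice:
  "tr2 (slice a \<alpha> m y z) = 3 * \<alpha>\<^sup>2 / 2 + 8 * m + 8 * y * z"
  "tr3 (slice a \<alpha> m y z) = 3 * (\<alpha> ^ 3 / 4 - 4 * \<alpha> * y * z + 2 * m * \<alpha> + 4 * m\<^sup>2 * z + 4 * y)"
  "mom0 (slice a \<alpha> m y z) = a\<^sup>2"
  "mom1 (slice a \<alpha> m y z) = a\<^sup>2 * \<alpha>"
  "mom2 (slice a \<alpha> m y z) = a\<^sup>2 * (\<alpha>\<^sup>2 + 4 * m)"
  "vol (slice a \<alpha> m y z) = - 4 * \<i> * a ^ 3 * (y - m\<^sup>2 * z)"
  unfolding slice_def gen_simps
  using i_squared by (simp_all add: field_simps power2_eq_square power3_eq_cube)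

lemma gram_det_slice:
  "gram_det (8 * k + 3 * \<alpha>\<^sup>2 / 2 + 8 * m) (3 * (4 * l + \<alpha> ^ 3 / 4 - 4 * \<alpha> * k + 2 * m * \<alpha>)) q0 (q0 * \<alpha>) (q0 * (\<alpha>\<^sup>2 + 4 * m))
    = 16 * q0 ^ 3 * (4 * m\<^sup>2 * k - l\<^sup>2)"
  unfolding gram_det_def Let_def by Groebner_Basis.algebra

text \<open>
  The invariants determine \<open>\<alpha>\<close>, \<open>m\<close>, the product \<open>k = y z\<close>, the sum \<open>l = y + m\<^sup>2 z\<close> and the difference
  \<open>r = y - m\<^sup>2 z\<close>. The consistency condition \<open>l\<^sup>2 - r\<^sup>2 = 4 m\<^sup>2 k\<close> is the equation for \<open>d\<^sup>2\<close>.
\<close>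

lemma slice_exists:
  assumes d: "d\<^sup>2 = gram_det p2 p3 q0 q1 q2" and q0: "q0 \<noteq> 0" and h: "q0 * q2 - q1\<^sup>2 \<noteq> 0"
    and a: "a\<^sup>2 = q0"
    and \<alpha>: "\<alpha> = q1 / q0" and m: "m = (q0 * q2 - q1\<^sup>2) / (4 * q0\<^sup>2)"
    and k: "k = (p2 - 3 * \<alpha>\<^sup>2 / 2 - 8 * m) / 8"
    and l: "l = (p3 / 3 - \<alpha> ^ 3 / 4 + 4 * \<alpha> * k - 2 * m * \<alpha>) / 4"
    and r: "r = \<i> * a * d / (4 * q0\<^sup>2)"
    and x: "x = slice a \<alpha> m ((l + r) / 2) ((l - r) / (2 * m\<^sup>2))"
  shows "tr2 x = p2" "tr3 x = p3" "mom0 x = q0" "mom1 x = q1" "mom2 x = q2" "vol x = d"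
proof -
  define y where "y = (l + r) / 2"
  define z where "z = (l - r) / (2 * m\<^sup>2)"
  have x: "x = slice a \<alpha> m y z" by (simp add: x y_def z_def)
  have m0: "m \<noteq> 0" using q0 h by (simp add: m)
  have mz: "m\<^sup>2 * z = (l - r) / 2" using m0 by (simp add: z_def)
  have p2: "p2 = 8 * k + 3 * \<alpha>\<^sup>2 / 2 + 8 * m" by (simp add: k field_simps)
  have p3: "p3 = 3 * (4 * l + \<alpha> ^ 3 / 4 - 4 * \<alpha> * k + 2 * m * \<alpha>)" by (simp add: l field_simps)
  have q1: "q1 = q0 * \<alpha>" using q0 by (simp add: \<alpha>)
  have q2: "q2 = q0 * (\<alpha>\<^sup>2 + 4 * m)" using q0 by (simp add: \<alpha> m field_simps power2_eq_square)
  have dd: "d\<^sup>2 = 16 * q0 ^ 3 * (4 * m\<^sup>2 * k - l\<^sup>2)"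
    using d unfolding p2 p3 q1 q2 gram_det_slice .
  have "r\<^sup>2 = - (a\<^sup>2 * d\<^sup>2) / (16 * q0 ^ 4)"
    by (simp add: r power_divide power_mult_distrib flip: power_mult)
  also have "\<dots> = l\<^sup>2 - 4 * m\<^sup>2 * k"
    unfolding a dd using q0 by (simp add: field_simps eval_nat_numeral)
  finally have rr: "r\<^sup>2 = l\<^sup>2 - 4 * m\<^sup>2 * k" .
  have "m\<^sup>2 * (y * z) = y * (m\<^sup>2 * z)" by simp
  also have "\<dots> = (l\<^sup>2 - r\<^sup>2) / 4" unfolding mz y_def by (simp add: field_simps power2_eq_square)
  also have "\<dots> = m\<^sup>2 * k" by (simp add: rr)
  finally have yz: "y * z = k" using m0 by simp
  have sum: "y + m\<^sup>2 * z = l" and diff: "y - m\<^sup>2 * z = r"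
    unfolding mz y_def by (simp_all add: field_simps)
  show "tr2 x = p2"
    unfolding x invariants_slice p2 yz[symmetric] by simp
  show "tr3 x = p3"
    unfolding x invariants_slice p3 yz[symmetric] sum[symmetric] by (simp add: algebra_simps)
  show "mom0 x = q0" "mom1 x = q1" "mom2 x = q2"
    unfolding x invariants_slice a q1 q2 by simp_all
  have "4 * q0\<^sup>2 * r = \<i> * a * d" using q0 by (simp add: r)
  moreover have "\<i> * \<i> = - 1" by simp
  ultimately have "q0\<^sup>2 * (- 4 * \<i> * a ^ 3 * r) = q0\<^sup>2 * d"
    using a by Groebner_Basis.algebra
  then have "- 4 * \<i> * a ^ 3 * r = d"
    using q0 by (simp only: mult_cancel_left) simp
  then show "vol x = d" unfolding x invariants_slice diff .
qed

text \<open>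
  Points with \<open>q0 q2 = q1\<^sup>2\<close>: the slice with \<open>m = 0\<close>, where \<open>y = l\<close> and \<open>z = k / l\<close>. The inequality
  assumed says that \<open>l \<noteq> 0\<close>.
\<close>

lemma degenerate_slice_exists:
  assumes q0: "q0 \<noteq> 0" and nz: "2 * p3 * q0 ^ 3 - 6 * q1 ^ 3 + 3 * p2 * q0\<^sup>2 * q1 \<noteq> 0"
  obtains x where "x \<in> M30" "tr2 x = p2" "tr3 x = p3" "mom0 x = q0" "mom1 x = q1" "mom2 x = q1\<^sup>2 / q0"
proof -
  define \<alpha> where "\<alpha> = q1 / q0"
  define k where "k = (p2 - 3 * \<alpha>\<^sup>2 / 2) / 8"
  define l where "l = (p3 / 3 - \<alpha> ^ 3 / 4 + 4 * \<alpha> * k) / 4"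
  have "24 * q0 ^ 3 * l = 2 * p3 * q0 ^ 3 - 6 * q1 ^ 3 + 3 * p2 * q0\<^sup>2 * q1"
    using q0 by (simp add: l_def k_def \<alpha>_def field_simps eval_nat_numeral)
  with nz have l0: "l \<noteq> 0" by auto
  define x where "x = slice (csqrt q0) \<alpha> 0 l (k / l)"
  have lk: "4 * l * k / l = 4 * k" "8 * l * k / l = 8 * k" "l * (k / l) = k" using l0 by simp_all
  have "tr2 x = 3 * \<alpha>\<^sup>2 / 2 + 8 * (l * (k / l))"
    unfolding x_def invariants_slice by simp
  then have 1: "tr2 x = p2" unfolding lk by (simp add: k_def field_simps)
  have "tr3 x = 3 * (\<alpha> ^ 3 / 4 - 4 * \<alpha> * (l * (k / l)) + 4 * l)"
    unfolding x_def invariants_slice by simp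
  then have 2: "tr3 x = p3" unfolding lk by (simp add: l_def field_simps)
  have csq: "(csqrt q0)\<^sup>2 = q0" by simp
  have 3: "mom0 x = q0" "mom1 x = q1" "mom2 x = q1\<^sup>2 / q0"
    unfolding x_def invariants_slice csq using q0 by (simp_all add: \<alpha>_def power2_eq_square)
  show thesis by (rule that[of x]) (simp_all add: 1 2 3, simp add: x_def)
qed

text \<open>
  Matrices whose axial vector \<open>(0, 1, \<i>)\<close> is isotropic, so that \<open>q0 = 0\<close>.
\<close>

definition isotropic_slice :: "complex \<Rightarrow> complex \<Rightarrow> complex \<Rightarrow> complex \<Rightarrow> cmat3" where
  "isotropic_slice c q u w = gen 0 (w + c) (\<i> * (w - c)) (u + q) (\<i> * (u - q)) 0 1 \<i>"

lemma invariants_isotropic_slice: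
  "tr2 (isotropic_slice c q u w) = 8 * (q * u + c * w)" 
  "tr3 (isotropic_slice c q u w) = 12 * (q * w\<^sup>2 + c\<^sup>2 * u)"
 "mom0 (isotropic_slice c q u w) = 0" "mom1 (isotropic_slice c q u w) = 4 * q" 
"mom2 (isotropic_slice c q u w) = 4 * c\<^sup>2"
proof -
  have i: "\<i> * \<i> = - 1" by simp
  show  "tr2 (isotropic_slice c q u w) = 8 * (q * u + c * w)" 
    unfolding isotropic_slice_def gen_simps using i by Groebner_Basis.algebra
  show "tr3 (isotropic_slice c q u w) = 12 * (q * w\<^sup>2 + c\<^sup>2 * u)"
    unfolding isotropic_slice_def gen_simps using i by Groebner_Basis.algebra
  show "mom0 (isotropic_slice c q u w) = 0" 
    unfolding isotropic_slice_def gen_simps using i by Groebner_Basis.algebra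
  show "mom1 (isotropic_slice c q u w) = 4 * q" 
    unfolding isotropic_slice_def gen_simps using i by Groebner_Basis.algebra
  show "mom2 (isotropic_slice c q u w) = 4 * c\<^sup>2"
    unfolding isotropic_slice_def gen_simps using i by Groebner_Basis.algebra
qed

lemma isotropic_slice_exists:
  assumes q1: "q1 \<noteq> 0"
  obtains x where "x \<in> M30" "tr2 x = p2" "tr3 x = p3" "mom0 x = 0" "mom1 x = q1" "mom2 x = q2"
proof -
  define c where "c = csqrt q2 / 2"
  have "4 * c\<^sup>2 = (csqrt q2)\<^sup>2" by (simp add: c_def power_divide)
  then have c: "4 * c\<^sup>2 = q2" by simp
  define q where "q = q1 / 4"
  have q0: "q \<noteq> 0" using q1 by (simp add: q_def)
  \<comment> \<open>The equations for \<open>p2\<close> and \<open>p3\<close> reduce to a quadratic equation for \<open>w\<close>,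
    with discriminant \<open>s\<^sup>2\<close>.\<close>
  define s where "s = csqrt (c ^ 6 - 4 * q\<^sup>2 * (c\<^sup>2 * p2 / 8 - q * p3 / 12))"
  define w where "w = (c ^ 3 + s) / (2 * q\<^sup>2)"
  define u where "u = (p2 / 8 - c * w) / q"
  have ss: "s\<^sup>2 = c ^ 6 - 4 * q\<^sup>2 * (c\<^sup>2 * p2 / 8 - q * p3 / 12)" by (simp add: s_def)
  have s: "s = 2 * q\<^sup>2 * w - c ^ 3" using q0 by (simp add: w_def)
  have "4 * q\<^sup>2 * (q\<^sup>2 * w\<^sup>2 - c ^ 3 * w + c\<^sup>2 * p2 / 8 - q * p3 / 12)
      = (2 * q\<^sup>2 * w - c ^ 3)\<^sup>2 - (c ^ 6 - 4 * q\<^sup>2 * (c\<^sup>2 * p2 / 8 - q * p3 / 12))"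
    by (simp add: algebra_simps eval_nat_numeral)
  also have "\<dots> = 0" using ss by (simp add: s)
  finally have w: "q\<^sup>2 * w\<^sup>2 - c ^ 3 * w + c\<^sup>2 * p2 / 8 - q * p3 / 12 = 0" using q0 by simp
  have p2: "8 * (q * u + c * w) = p2" using q0 by (simp add: u_def field_simps)
  have "q * (q * w\<^sup>2 + c\<^sup>2 * u - p3 / 12)
      = q\<^sup>2 * w\<^sup>2 - c ^ 3 * w + c\<^sup>2 * (8 * (q * u + c * w)) / 8 - q * p3 / 12"
    by (simp add: algebra_simps eval_nat_numeral)
  also have "\<dots> = 0" unfolding p2 by (rule w)
  finally have e: "q * w\<^sup>2 + c\<^sup>2 * u = p3 / 12" using q0 by simp
  have p3: "12 * (q * w\<^sup>2 + c\<^sup>2 * u) = p3" unfolding e by simp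
  show thesis
  proof (rule that[of "isotropic_slice c q u w"])
    show "isotropic_slice c q u w \<in> M30" by (simp add: isotropic_slice_def)
  qed (simp_all only: invariants_isotropic_slice p2 p3 c, simp add: q_def)
qed

section \<open>Polynomial functions on traceless matrices\<close>

text \<open>
  The family indexed by \<open>1, ..., 6\<close> with the given members; recall that \<open>6 = 0\<close> in the index type.
\<close>

definition point :: "'a \<Rightarrow> 'a \<Rightarrow> 'a \<Rightarrow> 'a \<Rightarrow> 'a \<Rightarrow> 'a \<Rightarrow> 6 \<Rightarrow> 'a" where
  "point a b c d e f i =
    (if i = 1 then a else if i = 2 then b else if i = 3 then c else if i = 4 then d else if i = 5 then e else f)"

lemma point_simps [simp]:
  "point a b c d e f 1 = a" "point a b c d e f 2 = b" "point a b c d e f 3 = c"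
  "point a b c d e f 4 = d" "point a b c d e f 5 = e" "point a b c d e f 6 = f" "point a b c d e f 0 = f"
  by (simp_all add: point_def)

lemma UNIV_6: "(UNIV :: 6 set) = {1, 2, 3, 4, 5, 6}"
  by (rule card_subset_eq[symmetric]) simp_all

lemma forall_6: "(\<forall>i::6. P i) \<longleftrightarrow> P 1 \<and> P 2 \<and> P 3 \<and> P 4 \<and> P 5 \<and> P 6"
proof -
  have "(\<forall>i::6. P i) \<longleftrightarrow> (\<forall>i\<in>UNIV. P i)" by simp
  then show ?thesis unfolding UNIV_6 by simp
qed

lemma point_eta: "point (a 1) (a 2) (a 3) (a 4) (a 5) (a 6) = a"
  unfolding fun_eq_iff forall_6 by simp

lemma point_map: "h (point a b c d e f i) = point (h a) (h b) (h c) (h d) (h e) (h f) i"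
  by (simp add: point_def)

text \<open>
  Functions that agree on the traceless matrices with a polynomial in the entries.
\<close>

definition polyfun :: "(cmat3 \<Rightarrow> complex) \<Rightarrow> bool" where
  "polyfun f \<longleftrightarrow> (\<exists>p :: (3 \<times> 3) cpoly. \<forall>x\<in>M30. f x = cpoly_eval (\<lambda>(i, j). x $ i $ j) p)"

lemma polyfun_const: "polyfun (\<lambda>x. c)"
  unfolding polyfun_def by (rule exI[of _ "Const c"]) simp

lemma polyfun_entry: "polyfun (\<lambda>x. x $ i $ j)"
  unfolding polyfun_def by (rule exI[of _ "Var (i, j)"]) simp

lemma polyfun_add: "polyfun f \<Longrightarrow> polyfun g \<Longrightarrow> polyfun (\<lambda>x. f x + g x)"
  unfolding polyfun_def by (metis cpoly_eval_add)

lemma polyfun_mult: "polyfun f \<Longrightarrow> polyfun g \<Longrightarrow> polyfun (\<lambda>x. f x * g x)"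
  unfolding polyfun_def by (metis cpoly_eval_mult)

lemma polyfun_uminus: "polyfun f \<Longrightarrow> polyfun (\<lambda>x. - f x)"
  unfolding polyfun_def by (metis cpoly_eval_uminus)

lemma polyfun_diff: "polyfun f \<Longrightarrow> polyfun g \<Longrightarrow> polyfun (\<lambda>x. f x - g x)"
  unfolding polyfun_def by (metis cpoly_eval_diff)

lemma polyfun_power: "polyfun f \<Longrightarrow> polyfun (\<lambda>x. f x ^ n)"
  by (induction n) (simp_all add: polyfun_const polyfun_mult)

lemma polyfun_divide: "polyfun f \<Longrightarrow> polyfun (\<lambda>x. f x / c)"
  using polyfun_mult[OF _ polyfun_const[of "1 / c"]] by simp

lemma polyfun_cpoly_eval:
  fixes p :: "'v::finite cpoly"
  assumes "\<And>i. polyfun (\<lambda>x. a x i)"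
  shows "polyfun (\<lambda>x. cpoly_eval (a x) p)"
  by (induction p rule: cpoly_induct)
    (simp_all add: assms polyfun_const polyfun_add polyfun_mult)

lemma polyfun_invariants:
  "polyfun tr2" "polyfun tr3" "polyfun mom0" "polyfun mom1" "polyfun mom2" "polyfun vol"
proof -
  note defs = tr2_def[abs_def] tr3_def[abs_def] mom0_def[abs_def] mom1_def[abs_def] mom2_def[abs_def]
    vol_def[abs_def] krylov1_def krylov2_def sympart_def axial_def mat_simps vec_lambda_beta vector_3
  show "polyfun tr2" "polyfun tr3" "polyfun mom0" "polyfun mom1" "polyfun mom2" "polyfun vol"
    unfolding defs
    by (intro polyfun_add polyfun_mult polyfun_diff polyfun_divide polyfun_entry)+
qed

lemma polyfun_mom_det: "polyfun mom_det"
  unfolding mom_det_def[abs_def]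
  by (intro polyfun_diff polyfun_mult polyfun_power polyfun_invariants)

lemma polyfun_no_zero_divisors:
  assumes f: "polyfun f" and g: "polyfun g" and zero: "\<And>x. x \<in> M30 \<Longrightarrow> f x * g x = 0"
    and x: "x \<in> M30" "f x \<noteq> 0" and y: "y \<in> M30"
  shows "g y = 0"
proof -
  define en :: "cmat3 \<Rightarrow> 3 \<times> 3 \<Rightarrow> complex" where "en = (\<lambda>x (i, j). x $ i $ j)"
  obtain p where p: "\<And>x. x \<in> M30 \<Longrightarrow> f x = cpoly_eval (en x) p"
    using f unfolding polyfun_def en_def by blast
  obtain q where q: "\<And>x. x \<in> M30 \<Longrightarrow> g x = cpoly_eval (en x) q"
    using g unfolding polyfun_def en_def by blast
  have line: "(\<lambda>i. a i + t * (b i - a i)) \<in> en ` M30" if "a \<in> en ` M30" "b \<in> en ` M30" for a b t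
  proof -
    from that obtain u v where uv: "u \<in> M30" "a = en u" "v \<in> M30" "b = en v" by auto
    define w :: cmat3 where "w = (\<chi> i j. u $ i $ j + t * (v $ i $ j - u $ i $ j))"
    have "trace w = trace u + t * (trace v - trace u)"
      by (simp add: w_def trace_def sum_3 algebra_simps)
    then have "w \<in> M30" using uv by (simp add: M30_def)
    moreover have "(\<lambda>i. a i + t * (b i - a i)) = en w"
      unfolding uv by (auto simp: en_def w_def fun_eq_iff)
    ultimately show ?thesis by blast
  qed
  have "cpoly_eval (en y) q = 0"
  proof (rule cpoly_eval_no_zero_divisors[where V = "en ` M30" and a = "en x" and p = p, OF line])
    show "cpoly_eval a p * cpoly_eval a q = 0" if "a \<in> en ` M30" for a
      using that zero p q by auto
  qed (use x y p in auto)
  then show ?thesis using q y by simp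
qed

section \<open>Removing denominators\<close>

text \<open>
  Polynomials in \<open>p2, p3, q0, q1, q2\<close> are encoded as polynomials in six variables whose sixth variable
  is given the value \<open>0\<close>.
\<close>

definition val :: "6 cpoly \<Rightarrow> complex \<Rightarrow> complex \<Rightarrow> complex \<Rightarrow> complex \<Rightarrow> complex \<Rightarrow> complex" where
  "val P p2 p3 q0 q1 q2 = cpoly_eval (point p2 p3 q0 q1 q2 0) P"

lemma val_simps [simp]:
  "val (Const c) p2 p3 q0 q1 q2 = c"
  "val (P + Q) p2 p3 q0 q1 q2 = val P p2 p3 q0 q1 q2 + val Q p2 p3 q0 q1 q2"
  "val (P * Q) p2 p3 q0 q1 q2 = val P p2 p3 q0 q1 q2 * val Q p2 p3 q0 q1 q2"
  "val (P - Q) p2 p3 q0 q1 q2 = val P p2 p3 q0 q1 q2 - val Q p2 p3 q0 q1 q2"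
  "val (P ^ n) p2 p3 q0 q1 q2 = val P p2 p3 q0 q1 q2 ^ n"
  "val 0 p2 p3 q0 q1 q2 = 0" "val 1 p2 p3 q0 q1 q2 = 1" "val (numeral k) p2 p3 q0 q1 q2 = numeral k"
  "val (Var 1) p2 p3 q0 q1 q2 = p2" "val (Var 2) p2 p3 q0 q1 q2 = p3" "val (Var 3) p2 p3 q0 q1 q2 = q0"
  "val (Var 4) p2 p3 q0 q1 q2 = q1" "val (Var 5) p2 p3 q0 q1 q2 = q2" "val (Var 6) p2 p3 q0 q1 q2 = 0"
  by (simp_all add: val_def)

lemma val_Var: "val (Var i) p2 p3 q0 q1 q2 = point p2 p3 q0 q1 q2 0 i"
  by (simp add: val_def)

lemma val_subst:
  obtains Q where "\<And>p2 p3 q0 q1 q2. val Q p2 p3 q0 q1 q2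
    = val P (val a p2 p3 q0 q1 q2) (val b p2 p3 q0 q1 q2) (val c p2 p3 q0 q1 q2) (val d p2 p3 q0 q1 q2)
        (val e p2 p3 q0 q1 q2)"
proof -
  obtain Q where Q: "\<And>u. cpoly_eval u Q = cpoly_eval (\<lambda>i. cpoly_eval u (point a b c d e 0 i)) P"
    using cpoly_subst[where s = "point a b c d e 0" and p = P] by blast
  have "val Q p2 p3 q0 q1 q2
    = val P (val a p2 p3 q0 q1 q2) (val b p2 p3 q0 q1 q2) (val c p2 p3 q0 q1 q2) (val d p2 p3 q0 q1 q2)
        (val e p2 p3 q0 q1 q2)" for p2 p3 q0 q1 q2
    unfolding val_def Q point_map[where h = "cpoly_eval _"] cpoly_eval_0 ..
  with that show thesis by blast
qed

text \<open>
  A polynomial that vanishes wherever a fixed nonzero polynomial \<open>G\<close> does not is identically zero.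
\<close>

lemma val_zero_generic:
  assumes gen: "\<And>p2 p3 q0 q1 q2. val G p2 p3 q0 q1 q2 \<noteq> 0 \<Longrightarrow> val P p2 p3 q0 q1 q2 = 0"
    and nz: "val G a b c d e \<noteq> 0"
  shows "val P p2 p3 q0 q1 q2 = 0"
proof -
  define V :: "(6 \<Rightarrow> complex) set" where "V = {u. u 6 = 0}"
  have V: "u = point (u 1) (u 2) (u 3) (u 4) (u 5) 0" if "u \<in> V" for u
    using that point_eta[of u] by (simp add: V_def)
  have "cpoly_eval (point p2 p3 q0 q1 q2 0) P = 0"
  proof (rule cpoly_eval_no_zero_divisors[where V = V and p = G and a = "point a b c d e 0"])
    show "cpoly_eval u G * cpoly_eval u P = 0" if "u \<in> V" for u
      using gen[of "u 1" "u 2" "u 3" "u 4" "u 5"] V[OF that] by (auto simp: val_def)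
    show "cpoly_eval (point a b c d e 0) G \<noteq> 0" using nz by (simp add: val_def)
  qed (simp_all add: V_def)
  then show ?thesis by (simp add: val_def)
qed

text \<open>
  The value of a polynomial at \<open>tr2\<close>, \<open>tr3\<close>, \<open>mom0\<close>, \<open>mom1\<close>, \<open>mom2\<close>. These five invariants are even:
  transposition, which maps \<open>(s, v)\<close> to \<open>(s, -v)\<close>, fixes them.
\<close>

definition inv_val :: "6 cpoly \<Rightarrow> cmat3 \<Rightarrow> complex" where
  "inv_val P x = val P (tr2 x) (tr3 x) (mom0 x) (mom1 x) (mom2 x)"

lemma polyfun_inv_val: "polyfun (inv_val P)"
proof -
  have "\<forall>i. polyfun (\<lambda>x. point (tr2 x) (tr3 x) (mom0 x) (mom1 x) (mom2 x) 0 i)"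
    unfolding forall_6 by (simp add: polyfun_invariants polyfun_const)
  then show ?thesis unfolding inv_val_def[abs_def] val_def by (intro polyfun_cpoly_eval) simp
qed

lemma inv_val_transpose: "inv_val P (transpose x) = inv_val P x"
  by (simp add: inv_val_def invariants_transpose)

text \<open>
  The \<open>\<complex>[p2, p3, q0, q1, q2]\<close>-module generated by \<open>1\<close> and \<open>vol\<close>.
\<close>

definition inv_span :: "(cmat3 \<Rightarrow> complex) \<Rightarrow> bool" where
  "inv_span f \<longleftrightarrow> (\<exists>A B. \<forall>x\<in>M30. f x = inv_val A x + vol x * inv_val B x)"

text \<open>
  The Gram determinant as a polynomial.
\<close>

definition gram_poly :: "6 cpoly" where
  "gram_poly = (let q3 = Const (1/2) * Var 1 * Var 4 + Const (1/3) * Var 2 * Var 3;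
      q4 = Const (1/2) * Var 1 * Var 5 + Const (1/3) * Var 2 * Var 4
     in Var 3 * (Var 5 * q4 - q3\<^sup>2) - Var 4 * (Var 4 * q4 - Var 5 * q3) + Var 5 * (Var 4 * q3 - (Var 5)\<^sup>2))"

lemma val_gram_poly: "val gram_poly p2 p3 q0 q1 q2 = gram_det p2 p3 q0 q1 q2"
  by (simp add: gram_poly_def gram_det_def Let_def)

lemma vol_squared_inv_val: "x \<in> M30 \<Longrightarrow> (vol x)\<^sup>2 = inv_val gram_poly x"
  by (simp add: vol_squared inv_val_def val_gram_poly)

lemma polyfun_cancel:
  assumes "polyfun w" "polyfun f" "polyfun g" "\<And>x. x \<in> M30 \<Longrightarrow> w x * f x = w x * g x"
    and "z \<in> M30" "w z \<noteq> 0" "x \<in> M30"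
  shows "f x = g x"
proof -
  have "f x - g x = 0"
  proof (rule polyfun_no_zero_divisors[of w "\<lambda>x. f x - g x"])
    show "polyfun (\<lambda>x. f x - g x)" using assms(2,3) by (rule polyfun_diff)
  qed (use assms in \<open>auto simp: right_diff_distrib\<close>)
  then show ?thesis by simp
qed

lemma mom_nonzero:
  obtains z where "z \<in> M30" "mom0 z \<noteq> 0" "mom_det z \<noteq> 0"
proof
  show "slice 1 0 1 0 0 \<in> M30" by simp
  show "mom0 (slice 1 0 1 0 0) \<noteq> 0" "mom_det (slice 1 0 1 0 0) \<noteq> 0"
    by (simp_all add: invariants_slice mom_det_def)
qed

lemma val_subst_mom0:
  obtains Q where "\<And>p2 p3 q0 q1 q2. val Q p2 p3 q0 q1 q2 = val P p2 p3 0 q1 q2"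
  by (rule val_subst[of P "Var 1" "Var 2" 0 "Var 4" "Var 5"], rule that) simp

lemma val_subst_mom2:
  obtains Q where "\<And>p2 p3 q0 q1 q2. val Q p2 p3 q0 q1 q2 = val P p2 p3 q0 q1 0"
  by (rule val_subst[of P "Var 1" "Var 2" "Var 3" "Var 4" 0], rule that) simp

text \<open>
  Every polynomial is congruent, modulo \<open>q0\<close>, to its restriction to \<open>q0 = 0\<close>.
\<close>

lemma val_split_mom0:
  obtains P' where "\<And>p2 p3 q0 q1 q2. val P p2 p3 q0 q1 q2 = val P p2 p3 0 q1 q2 + q0 * val P' p2 p3 q0 q1 q2"
proof -
  have "\<exists>P'. \<forall>p2 p3 q0 q1 q2. val P p2 p3 q0 q1 q2 = val P p2 p3 0 q1 q2 + q0 * val P' p2 p3 q0 q1 q2"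
  proof (induction P rule: cpoly_induct)
    case (Const c)
    show ?case by (rule exI[of _ 0]) simp
  next
    case (Var i)
    show ?case
      by (rule exI[of _ "if i = 3 then 1 else 0"]) (auto simp: val_Var point_def)
  next
    case (add P Q)
    then obtain P' Q' where "\<forall>p2 p3 q0 q1 q2. val P p2 p3 q0 q1 q2 = val P p2 p3 0 q1 q2 + q0 * val P' p2 p3 q0 q1 q2"
      "\<forall>p2 p3 q0 q1 q2. val Q p2 p3 q0 q1 q2 = val Q p2 p3 0 q1 q2 + q0 * val Q' p2 p3 q0 q1 q2" by blast
    note * = this[rule_format]
    show ?case
    proof (intro exI[of _ "P' + Q'"] allI)
      fix p2 p3 q0 q1 q2
      show "val (P + Q) p2 p3 q0 q1 q2 = val (P + Q) p2 p3 0 q1 q2 + q0 * val (P' + Q') p2 p3 q0 q1 q2"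
        using *(1)[of p2 p3 q0 q1 q2] *(2)[of p2 p3 q0 q1 q2] by (simp add: algebra_simps)
    qed
  next
    case (mult P Q)
    then obtain P' Q' where "\<forall>p2 p3 q0 q1 q2. val P p2 p3 q0 q1 q2 = val P p2 p3 0 q1 q2 + q0 * val P' p2 p3 q0 q1 q2"
      "\<forall>p2 p3 q0 q1 q2. val Q p2 p3 q0 q1 q2 = val Q p2 p3 0 q1 q2 + q0 * val Q' p2 p3 q0 q1 q2" by blast
    note * = this[rule_format]
    obtain R where R: "\<And>p2 p3 q0 q1 q2. val R p2 p3 q0 q1 q2 = val Q p2 p3 0 q1 q2"
      by (rule val_subst_mom0[of Q], rule that)
    show ?case
    proof (intro exI[of _ "P * Q' + R * P'"] allI)
      fix p2 p3 q0 q1 q2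
      have "val P p2 p3 q0 q1 q2 * val Q p2 p3 q0 q1 q2
        = val P p2 p3 q0 q1 q2 * (val Q p2 p3 0 q1 q2 + q0 * val Q' p2 p3 q0 q1 q2)"
        using *(2)[of p2 p3 q0 q1 q2] by simp
      also have "\<dots> = (val P p2 p3 0 q1 q2 + q0 * val P' p2 p3 q0 q1 q2) * val Q p2 p3 0 q1 q2
         + val P p2 p3 q0 q1 q2 * (q0 * val Q' p2 p3 q0 q1 q2)"
        by (simp add: distrib_left *(1)[of p2 p3 q0 q1 q2, symmetric])
      finally show "val (P * Q) p2 p3 q0 q1 q2 = val (P * Q) p2 p3 0 q1 q2 + q0 * val (P * Q' + R * P') p2 p3 q0 q1 q2"
        by (simp add: R algebra_simps)
    qed
  qed
  with that show thesis by blast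
qed

text \<open>
  Pseudo-division by \<open>q0 q2 - q1\<^sup>2\<close>, a polynomial of degree one in \<open>q2\<close> with leading coefficient \<open>q0\<close>.
  The remainder does not depend on \<open>q2\<close>.
\<close>

lemma val_pseudo_division:
  obtains n P' R where "\<And>p2 p3 q0 q1 q2. q0 ^ n * val P p2 p3 q0 q1 q2
      = (q0 * q2 - q1\<^sup>2) * val P' p2 p3 q0 q1 q2 + val R p2 p3 q0 q1 0"
proof -
  have "\<exists>n P' R. \<forall>p2 p3 q0 q1 q2. q0 ^ n * val P p2 p3 q0 q1 q2
      = (q0 * q2 - q1\<^sup>2) * val P' p2 p3 q0 q1 q2 + val R p2 p3 q0 q1 0"
  proof (induction P rule: cpoly_induct)
    case (Const c)
    show ?case by (rule exI[of _ 0], rule exI[of _ 0], rule exI[of _ "Const c"]) simp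
  next
    case (Var i)
    show ?case
    proof (cases "i = 5")
      case True
      show ?thesis unfolding True
        by (rule exI[of _ 1], rule exI[of _ 1], rule exI[of _ "(Var 4)\<^sup>2"]) simp
    next
      case False
      show ?thesis
        by (rule exI[of _ 0], rule exI[of _ 0], rule exI[of _ "Var i"])
          (use False in \<open>auto simp: val_Var point_def\<close>)
    qed
  next
    case (add P Q)
    then obtain n P' R m Q' S where P: "\<forall>p2 p3 q0 q1 q2. q0 ^ n * val P p2 p3 q0 q1 q2
      = (q0 * q2 - q1\<^sup>2) * val P' p2 p3 q0 q1 q2 + val R p2 p3 q0 q1 0"
      and Q: "\<forall>p2 p3 q0 q1 q2. q0 ^ m * val Q p2 p3 q0 q1 q2
      = (q0 * q2 - q1\<^sup>2) * val Q' p2 p3 q0 q1 q2 + val S p2 p3 q0 q1 0" by blast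
    show ?case
    proof (rule exI[of _ "n + m"], rule exI[of _ "Var 3 ^ m * P' + Var 3 ^ n * Q'"],
        rule exI[of _ "Var 3 ^ m * R + Var 3 ^ n * S"], intro allI)
      fix p2 p3 q0 q1 q2
      have "q0 ^ (n + m) * val (P + Q) p2 p3 q0 q1 q2
        = q0 ^ m * (q0 ^ n * val P p2 p3 q0 q1 q2) + q0 ^ n * (q0 ^ m * val Q p2 p3 q0 q1 q2)"
        by (simp add: power_add algebra_simps)
      then show "q0 ^ (n + m) * val (P + Q) p2 p3 q0 q1 q2
        = (q0 * q2 - q1\<^sup>2) * val (Var 3 ^ m * P' + Var 3 ^ n * Q') p2 p3 q0 q1 q2
          + val (Var 3 ^ m * R + Var 3 ^ n * S) p2 p3 q0 q1 0"
        unfolding P[rule_format] Q[rule_format] by (simp add: algebra_simps)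
    qed
  next
    case (mult P Q)
    then obtain n P' R m Q' S where P: "\<forall>p2 p3 q0 q1 q2. q0 ^ n * val P p2 p3 q0 q1 q2
      = (q0 * q2 - q1\<^sup>2) * val P' p2 p3 q0 q1 q2 + val R p2 p3 q0 q1 0"
      and Q: "\<forall>p2 p3 q0 q1 q2. q0 ^ m * val Q p2 p3 q0 q1 q2
      = (q0 * q2 - q1\<^sup>2) * val Q' p2 p3 q0 q1 q2 + val S p2 p3 q0 q1 0" by blast
    obtain R' where R': "\<And>p2 p3 q0 q1 q2. val R' p2 p3 q0 q1 q2 = val R p2 p3 q0 q1 0"
      by (rule val_subst_mom2[of R], rule that)
    obtain S' where S': "\<And>p2 p3 q0 q1 q2. val S' p2 p3 q0 q1 q2 = val S p2 p3 q0 q1 0"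
      by (rule val_subst_mom2[of S], rule that)
    show ?case
    proof (rule exI[of _ "n + m"], rule exI[of _ "P' * ((Var 3 * Var 5 - (Var 4)\<^sup>2) * Q' + S') + R' * Q'"],
        rule exI[of _ "R * S"], intro allI)
      fix p2 p3 q0 q1 q2
      have "q0 ^ (n + m) * val (P * Q) p2 p3 q0 q1 q2
        = (q0 ^ n * val P p2 p3 q0 q1 q2) * (q0 ^ m * val Q p2 p3 q0 q1 q2)"
        by (simp add: power_add)
      then show "q0 ^ (n + m) * val (P * Q) p2 p3 q0 q1 q2
        = (q0 * q2 - q1\<^sup>2) * val (P' * ((Var 3 * Var 5 - (Var 4)\<^sup>2) * Q' + S') + R' * Q') p2 p3 q0 q1 q2
          + val (R * S) p2 p3 q0 q1 0"
        unfolding P[rule_format] Q[rule_format] by (simp add: R' S' algebra_simps)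
    qed
  qed
  with that show thesis by blast
qed

text \<open>
  Transposition fixes the even invariants and changes the sign of the volume. So if \<open>A + vol B\<close>
  vanishes at a matrix and at its transpose, then \<open>A\<close> and \<open>vol B\<close> vanish separately. The latter is
  multiplied by \<open>vol\<close>, to obtain an equation between polynomials in the even invariants.
\<close>

lemma even_odd_vanish:
  assumes "x \<in> M30" "\<And>x. x \<in> M30 \<Longrightarrow> f x = 0 \<Longrightarrow> inv_val A x + vol x * inv_val B x = 0"
    "f x = 0" "f (transpose x) = 0"
  shows "inv_val A x = 0" "inv_val gram_poly x * inv_val B x = 0"
proof -
  have 1: "inv_val A x + vol x * inv_val B x = 0" using assms by blast
  have 2: "inv_val A x - vol x * inv_val B x = 0"
    using assms(2)[OF transpose_M30[OF assms(1)] assms(4)]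
    by (simp add: inv_val_transpose invariants_transpose)
  have "2 * inv_val A x = 0" using arg_cong2[OF 1 2, of "(+)"] by simp
  then show A: "inv_val A x = 0" by simp
  have "inv_val gram_poly x * inv_val B x = vol x * (vol x * inv_val B x)"
    by (simp add: vol_squared_inv_val[OF assms(1), symmetric] power2_eq_square)
  with 1 A show "inv_val gram_poly x * inv_val B x = 0" by auto
qed

lemma inv_span_divide_mom0:
  assumes f: "polyfun f" and span: "inv_span (\<lambda>x. mom0 x * f x)"
  shows "inv_span f"
proof -
  obtain A B where AB: "\<And>x. x \<in> M30 \<Longrightarrow> mom0 x * f x = inv_val A x + vol x * inv_val B x"
    using span unfolding inv_span_def by blast
  have van: "val A p2 p3 0 q1 q2 = 0 \<and> gram_det p2 p3 0 q1 q2 * val B p2 p3 0 q1 q2 = 0" if q1: "q1 \<noteq> 0" for p2 p3 q1 q2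
  proof -
    obtain x where x: "x \<in> M30" "tr2 x = p2" "tr3 x = p3" "mom0 x = 0" "mom1 x = q1" "mom2 x = q2"
      using isotropic_slice_exists[OF q1] by blast
    have "inv_val A x = 0" "inv_val gram_poly x * inv_val B x = 0"
      by (rule even_odd_vanish[of x mom0 A B]; use x AB in \<open>force simp: invariants_transpose\<close>)+
    then show ?thesis by (simp add: inv_val_def x val_gram_poly)
  qed
  obtain A0 where A0: "\<And>p2 p3 q0 q1 q2. val A0 p2 p3 q0 q1 q2 = val A p2 p3 0 q1 q2"
    by (rule val_subst_mom0[of A], rule that)
  obtain B0 where B0: "\<And>p2 p3 q0 q1 q2. val B0 p2 p3 q0 q1 q2 = val B p2 p3 0 q1 q2"
    by (rule val_subst_mom0[of B], rule that)
  obtain G where G: "\<And>p2 p3 q0 q1 q2. val G p2 p3 q0 q1 q2 = gram_det p2 p3 0 q1 q2"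
    by (rule val_subst_mom0[of gram_poly, unfolded val_gram_poly], rule that)
  have A00: "val A p2 p3 0 q1 q2 = 0" for p2 p3 q1 q2
    using val_zero_generic[of "Var 4" A0 0 0 0 1 0 p2 p3 0 q1 q2] van by (simp add: A0)
  have B00: "val B p2 p3 0 q1 q2 = 0" for p2 p3 q1 q2
  proof -
    have "val B0 p2 p3 0 q1 q2 = 0"
    proof (rule val_zero_generic[of "Var 4 * G"])
      \<comment> \<open>On \<open>q0 = 0\<close> the Gram determinant is not identically zero, so it may be cancelled.\<close>
      show "val B0 p2 p3 q0 q1 q2 = 0" if "val (Var 4 * G) p2 p3 q0 q1 q2 \<noteq> 0" for p2 p3 q0 q1 q2
        using that van[of q1 p2 p3 q2] by (auto simp: B0 G)
      have "gram_det 0 3 0 1 0 \<noteq> 0" by (simp add: gram_det_def)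
      then show "val (Var 4 * G) 0 3 0 1 0 \<noteq> 0" by (simp add: G)
    qed
    then show ?thesis by (simp add: B0)
  qed
  obtain A' where A': "\<And>p2 p3 q0 q1 q2. val A p2 p3 q0 q1 q2 = val A p2 p3 0 q1 q2 + q0 * val A' p2 p3 q0 q1 q2"
    by (rule val_split_mom0, rule that)
  obtain B' where B': "\<And>p2 p3 q0 q1 q2. val B p2 p3 q0 q1 q2 = val B p2 p3 0 q1 q2 + q0 * val B' p2 p3 q0 q1 q2"
    by (rule val_split_mom0, rule that)
  have "mom0 x * f x = mom0 x * (inv_val A' x + vol x * inv_val B' x)" if "x \<in> M30" for x
    using AB[OF that] A'[of "tr2 x" "tr3 x" "mom0 x"] B'[of "tr2 x" "tr3 x" "mom0 x"]
    by (simp add: inv_val_def A00 B00 algebra_simps)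
  moreover obtain z where "z \<in> M30" "mom0 z \<noteq> 0" using mom_nonzero by blast
  moreover have "polyfun (\<lambda>x. inv_val A' x + vol x * inv_val B' x)"
    by (intro polyfun_add polyfun_mult polyfun_inv_val polyfun_invariants)
  ultimately have "f x = inv_val A' x + vol x * inv_val B' x" if "x \<in> M30" for x
    using polyfun_cancel[OF polyfun_invariants(3) f] that by blast
  then show ?thesis unfolding inv_span_def by blast
qed

lemma inv_span_divide_mom0_power:
  assumes f: "polyfun f" and span: "inv_span (\<lambda>x. mom0 x ^ n * f x)"
  shows "inv_span f"
  using span
proof (induction n)
  case (Suc n)
  have "inv_span (\<lambda>x. mom0 x * (mom0 x ^ n * f x))"
    using Suc.prems by (simp add: mult.assoc)
  then have "inv_span (\<lambda>x. mom0 x ^ n * f x)"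
    by (rule inv_span_divide_mom0[rotated]) (intro polyfun_mult polyfun_power polyfun_invariants f)
  then show ?case by (rule Suc.IH)
qed simp

lemma inv_span_divide_mom_det:
  assumes f: "polyfun f" and span: "inv_span (\<lambda>x. mom_det x * f x)"
  shows "inv_span f"
proof -
  obtain A B where AB: "\<And>x. x \<in> M30 \<Longrightarrow> mom_det x * f x = inv_val A x + vol x * inv_val B x"
    using span unfolding inv_span_def by blast
  have van: "val A p2 p3 q0 q1 (q1\<^sup>2 / q0) = 0
      \<and> gram_det p2 p3 q0 q1 (q1\<^sup>2 / q0) * val B p2 p3 q0 q1 (q1\<^sup>2 / q0) = 0"
    if nz: "q0 \<noteq> 0" "2 * p3 * q0 ^ 3 - 6 * q1 ^ 3 + 3 * p2 * q0\<^sup>2 * q1 \<noteq> 0" for p2 p3 q0 q1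
  proof -
    obtain x where x: "x \<in> M30" "tr2 x = p2" "tr3 x = p3" "mom0 x = q0" "mom1 x = q1" "mom2 x = q1\<^sup>2 / q0"
      using degenerate_slice_exists[OF nz] by blast
    then have det: "mom_det x = 0" using nz by (simp add: mom_det_def)
    have "inv_val A x = 0" "inv_val gram_poly x * inv_val B x = 0"
      by (rule even_odd_vanish[of x mom_det A B]; use x det AB in \<open>force simp: invariants_transpose mom_det_def\<close>)+
    then show ?thesis by (simp add: inv_val_def x val_gram_poly)
  qed
  \<comment> \<open>Modulo \<open>q0 q2 - q1\<^sup>2\<close>, the polynomials \<open>G\<close>, \<open>R\<close>, \<open>S\<close> represent the Gram determinant,
    \<open>A\<close> and \<open>B\<close>, up to powers of \<open>q0\<close>.\<close>
  obtain k G' G where G: "\<And>p2 p3 q0 q1 q2. q0 ^ k * gram_det p2 p3 q0 q1 q2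
      = (q0 * q2 - q1\<^sup>2) * val G' p2 p3 q0 q1 q2 + val G p2 p3 q0 q1 0"
    by (rule val_pseudo_division[of gram_poly, unfolded val_gram_poly], rule that)
  obtain n A' R where A': "\<And>p2 p3 q0 q1 q2. q0 ^ n * val A p2 p3 q0 q1 q2
      = (q0 * q2 - q1\<^sup>2) * val A' p2 p3 q0 q1 q2 + val R p2 p3 q0 q1 0"
    by (rule val_pseudo_division, rule that)
  obtain m B' S where B': "\<And>p2 p3 q0 q1 q2. q0 ^ m * val B p2 p3 q0 q1 q2
      = (q0 * q2 - q1\<^sup>2) * val B' p2 p3 q0 q1 q2 + val S p2 p3 q0 q1 0"
    by (rule val_pseudo_division, rule that)
  obtain R0 where R0: "\<And>p2 p3 q0 q1 q2. val R0 p2 p3 q0 q1 q2 = val R p2 p3 q0 q1 0"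
    by (rule val_subst_mom2[of R], rule that)
  obtain S0 where S0: "\<And>p2 p3 q0 q1 q2. val S0 p2 p3 q0 q1 q2 = val S p2 p3 q0 q1 0"
    by (rule val_subst_mom2[of S], rule that)
  obtain G0 where G0: "\<And>p2 p3 q0 q1 q2. val G0 p2 p3 q0 q1 q2 = val G p2 p3 q0 q1 0"
    by (rule val_subst_mom2[of G], rule that)
  define L :: "6 cpoly" where
    "L = Var 3 * (2 * Var 2 * Var 3 ^ 3 - 6 * Var 4 ^ 3 + 3 * Var 1 * (Var 3)\<^sup>2 * Var 4)"
  have L: "val L p2 p3 q0 q1 q2 = q0 * (2 * p3 * q0 ^ 3 - 6 * q1 ^ 3 + 3 * p2 * q0\<^sup>2 * q1)" for p2 p3 q0 q1 q2
    by (simp add: L_def)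
  have R00: "val R p2 p3 q0 q1 0 = 0" for p2 p3 q0 q1
  proof -
    have "val R0 p2 p3 q0 q1 0 = 0"
    proof (rule val_zero_generic[of L])
      fix p2 p3 q0 q1 q2
      assume "val L p2 p3 q0 q1 q2 \<noteq> 0"
      then have "q0 \<noteq> 0" "val A p2 p3 q0 q1 (q1\<^sup>2 / q0) = 0" using van by (auto simp: L)
      with A'[of q0 p2 p3 q1 "q1\<^sup>2 / q0"] show "val R0 p2 p3 q0 q1 q2 = 0" by (simp add: R0)
    next
      show "val L 0 3 1 0 0 \<noteq> 0" by (simp add: L)
    qed
    then show ?thesis by (simp add: R0)
  qed
  have S00: "val S p2 p3 q0 q1 0 = 0" for p2 p3 q0 q1
  proof -
    have "val S0 p2 p3 q0 q1 0 = 0"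
    proof (rule val_zero_generic[of "L * G0"])
      fix p2 p3 q0 q1 q2
      assume nz: "val (L * G0) p2 p3 q0 q1 q2 \<noteq> 0"
      then have q0: "q0 \<noteq> 0" by (auto simp: L)
      have "gram_det p2 p3 q0 q1 (q1\<^sup>2 / q0) \<noteq> 0"
        using G[of q0 p2 p3 q1 "q1\<^sup>2 / q0"] nz q0 by (auto simp: G0)
      then have "val B p2 p3 q0 q1 (q1\<^sup>2 / q0) = 0" using van nz by (auto simp: L)
      with q0 B'[of q0 p2 p3 q1 "q1\<^sup>2 / q0"] show "val S0 p2 p3 q0 q1 q2 = 0" by (simp add: S0)
    next
      have "val G 0 3 1 0 0 = - 1" using G[of 1 0 3 0 0] by (simp add: gram_det_def)
      then show "val (L * G0) 0 3 1 0 0 \<noteq> 0" by (simp add: L G0)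
    qed
    then show ?thesis by (simp add: S0)
  qed
  have "mom_det x * (mom0 x ^ (n + m) * f x)
      = mom_det x * (inv_val (Var 3 ^ m * A') x + vol x * inv_val (Var 3 ^ n * B') x)" if "x \<in> M30" for x
  proof -
    have "mom_det x * (mom0 x ^ (n + m) * f x) = mom0 x ^ (n + m) * (mom_det x * f x)" by simp
    also have "\<dots> = mom0 x ^ m * (mom0 x ^ n * inv_val A x) + vol x * (mom0 x ^ n * (mom0 x ^ m * inv_val B x))"
      unfolding AB[OF that] by (simp add: power_add algebra_simps)
    also have "\<dots> = mom_det x * (inv_val (Var 3 ^ m * A') x + vol x * inv_val (Var 3 ^ n * B') x)"
      unfolding inv_val_def A' B' R00 S00 mom_det_def by (simp add: algebra_simps)
    finally show ?thesis .
  qed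
  moreover obtain z where "z \<in> M30" "mom_det z \<noteq> 0" using mom_nonzero by blast
  moreover have "polyfun (\<lambda>x. inv_val (Var 3 ^ m * A') x + vol x * inv_val (Var 3 ^ n * B') x)"
    by (intro polyfun_add polyfun_mult polyfun_inv_val polyfun_invariants)
  moreover have "polyfun (\<lambda>x. mom0 x ^ (n + m) * f x)"
    by (intro polyfun_mult polyfun_power polyfun_invariants f)
  ultimately have "mom0 x ^ (n + m) * f x = inv_val (Var 3 ^ m * A') x + vol x * inv_val (Var 3 ^ n * B') x"
    if "x \<in> M30" for x
    using polyfun_cancel[OF polyfun_mom_det] that by blast
  then have "inv_span (\<lambda>x. mom0 x ^ (n + m) * f x)" unfolding inv_span_def by blast
  then show ?thesis by (rule inv_span_divide_mom0_power[OF f])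
qed

lemma inv_span_divide_power:
  assumes f: "polyfun f" and span: "inv_span (\<lambda>x. (mom0 x * mom_det x) ^ n * f x)"
  shows "inv_span f"
  using span
proof (induction n)
  case (Suc n)
  have "inv_span (\<lambda>x. mom0 x * (mom_det x * ((mom0 x * mom_det x) ^ n * f x)))"
    using Suc.prems by (simp add: mult_ac)
  then have "inv_span (\<lambda>x. mom_det x * ((mom0 x * mom_det x) ^ n * f x))"
    by (rule inv_span_divide_mom0[rotated])
      (intro polyfun_mult polyfun_power polyfun_invariants polyfun_mom_det f)
  then have "inv_span (\<lambda>x. (mom0 x * mom_det x) ^ n * f x)"
    by (rule inv_span_divide_mom_det[rotated])
      (intro polyfun_mult polyfun_power polyfun_invariants polyfun_mom_det f)
  then show ?case by (rule Suc.IH)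
qed simp

section \<open>Generators of the algebra of invariants\<close>

text \<open>
  All six basic invariants of a matrix.
\<close>

definition invs :: "cmat3 \<Rightarrow> 6 \<Rightarrow> complex" where
  "invs x = point (tr2 x) (tr3 x) (mom0 x) (mom1 x) (mom2 x) (vol x)"

lemma inv_val_simps [simp]:
  "inv_val (Const c) x = c" "inv_val 0 x = 0" "inv_val 1 x = 1"
  "inv_val (P + Q) x = inv_val P x + inv_val Q x"
  "inv_val (P * Q) x = inv_val P x * inv_val Q x"
  by (simp_all add: inv_val_def)

lemma inv_val_Var: "inv_val (Var i) x = point (tr2 x) (tr3 x) (mom0 x) (mom1 x) (mom2 x) 0 i"
  by (simp add: inv_val_def val_Var)

lemma inv_span_cpoly_eval: "inv_span (\<lambda>x. cpoly_eval (invs x) P)"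
proof (induction P rule: cpoly_induct)
  case (Const c)
  show ?case unfolding inv_span_def by (rule exI[of _ "Const c"], rule exI[of _ 0]) simp
next
  case (Var i)
  show ?case unfolding inv_span_def
  proof (rule exI[of _ "if i = 6 then 0 else Var i"], rule exI[of _ "if i = 6 then 1 else 0"], rule ballI)
    fix x
    have "\<forall>i. cpoly_eval (invs x) (Var i)
      = inv_val (if i = 6 then 0 else Var i) x + vol x * inv_val (if i = 6 then 1 else 0) x"
      unfolding forall_6 by (simp add: inv_val_Var invs_def)
    then show "cpoly_eval (invs x) (Var i)
      = inv_val (if i = 6 then 0 else Var i) x + vol x * inv_val (if i = 6 then 1 else 0) x" ..
  qed
next
  case (add P Q)
  then obtain A B C D where *: "\<forall>x\<in>M30. cpoly_eval (invs x) P = inv_val A x + vol x * inv_val B x"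
    "\<forall>x\<in>M30. cpoly_eval (invs x) Q = inv_val C x + vol x * inv_val D x"
    unfolding inv_span_def by blast
  show ?case unfolding inv_span_def
    by (rule exI[of _ "A + C"], rule exI[of _ "B + D"]) (use * in \<open>simp add: algebra_simps\<close>)
next
  case (mult P Q)
  then obtain A B C D where AB: "\<forall>x\<in>M30. cpoly_eval (invs x) P = inv_val A x + vol x * inv_val B x"
    and CD: "\<forall>x\<in>M30. cpoly_eval (invs x) Q = inv_val C x + vol x * inv_val D x"
    unfolding inv_span_def by blast
  show ?case unfolding inv_span_def
  proof (rule exI[of _ "A * C + gram_poly * (B * D)"], rule exI[of _ "A * D + B * C"], rule ballI)
    fix x assume x: "x \<in> M30"
    have "cpoly_eval (invs x) (P * Q)
      = inv_val A x * inv_val C x + (vol x)\<^sup>2 * (inv_val B x * inv_val D x)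
        + vol x * (inv_val A x * inv_val D x + inv_val B x * inv_val C x)"
      using x AB CD by (simp add: algebra_simps power2_eq_square)
    then show "cpoly_eval (invs x) (P * Q) = inv_val (A * C + gram_poly * (B * D)) x
        + vol x * inv_val (A * D + B * C) x"
      by (simp add: vol_squared_inv_val[OF x])
  qed
qed

text \<open>
  Functions of a matrix \<open>x\<close> with \<open>q0 H \<noteq> 0\<close> and a square root \<open>a\<close> of \<open>q0\<close> that have the form
  \<open>(P + a Q) / (q0 H)\<^sup>n\<close> with polynomials \<open>P\<close>, \<open>Q\<close> in the six basic invariants. They form a ring.
\<close>

definition frac_fun :: "(complex \<Rightarrow> cmat3 \<Rightarrow> complex) \<Rightarrow> bool" where
  "frac_fun F \<longleftrightarrow> (\<exists>n P Q. \<forall>x\<in>M30. \<forall>a. a\<^sup>2 = mom0 x \<longrightarrow> mom0 x \<noteq> 0 \<longrightarrow> mom_det x \<noteq> 0 \<longrightarrow>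
     (mom0 x * mom_det x) ^ n * F a x = cpoly_eval (invs x) P + a * cpoly_eval (invs x) Q)"

text \<open>
  The polynomial \<open>q0 H\<close>.
\<close>

definition weight_poly :: "6 cpoly" where
  "weight_poly = Var 3 * (Var 3 * Var 5 - (Var 4)\<^sup>2)"

lemma cpoly_eval_weight: "cpoly_eval (invs x) weight_poly = mom0 x * mom_det x"
  by (simp add: weight_poly_def invs_def mom_det_def)

lemma frac_fun_invs: "frac_fun (\<lambda>a x. cpoly_eval (invs x) P)"
  unfolding frac_fun_def by (rule exI[of _ 0], rule exI[of _ P], rule exI[of _ 0]) simp

lemma frac_fun_const: "frac_fun (\<lambda>a x. c)"
  using frac_fun_invs[of "Const c"] by simp

lemma frac_fun_root: "frac_fun (\<lambda>a x. a)"
  unfolding frac_fun_def by (rule exI[of _ 0], rule exI[of _ 0], rule exI[of _ 1]) simp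

lemma frac_fun_basic:
  "frac_fun (\<lambda>a. tr2)" "frac_fun (\<lambda>a. tr3)" "frac_fun (\<lambda>a. mom0)" "frac_fun (\<lambda>a. mom1)" "frac_fun (\<lambda>a. mom2)"
  "frac_fun (\<lambda>a. vol)"
  using frac_fun_invs[of "Var 1"] frac_fun_invs[of "Var 2"] frac_fun_invs[of "Var 3"]
    frac_fun_invs[of "Var 4"] frac_fun_invs[of "Var 5"] frac_fun_invs[of "Var 6"]
  by (simp_all add: invs_def)

lemma frac_fun_add:
  assumes "frac_fun F" "frac_fun G"
  shows "frac_fun (\<lambda>a x. F a x + G a x)"
proof -
  obtain n P Q where F: "\<And>x a. x \<in> M30 \<Longrightarrow> a\<^sup>2 = mom0 x \<Longrightarrow> mom0 x \<noteq> 0 \<Longrightarrow> mom_det x \<noteq> 0 \<Longrightarrow>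
     (mom0 x * mom_det x) ^ n * F a x = cpoly_eval (invs x) P + a * cpoly_eval (invs x) Q"
    using assms(1) unfolding frac_fun_def by blast
  obtain m R S where G: "\<And>x a. x \<in> M30 \<Longrightarrow> a\<^sup>2 = mom0 x \<Longrightarrow> mom0 x \<noteq> 0 \<Longrightarrow> mom_det x \<noteq> 0 \<Longrightarrow>
     (mom0 x * mom_det x) ^ m * G a x = cpoly_eval (invs x) R + a * cpoly_eval (invs x) S"
    using assms(2) unfolding frac_fun_def by blast
  show ?thesis unfolding frac_fun_def
  proof (rule exI[of _ "n + m"], rule exI[of _ "weight_poly ^ m * P + weight_poly ^ n * R"],
      rule exI[of _ "weight_poly ^ m * Q + weight_poly ^ n * S"], intro ballI allI impI)
    fix x a assume x: "x \<in> M30" "a\<^sup>2 = mom0 x" "mom0 x \<noteq> 0" "mom_det x \<noteq> 0"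
    define w where "w = mom0 x * mom_det x"
    have "w ^ (n + m) * (F a x + G a x) = w ^ m * (w ^ n * F a x) + w ^ n * (w ^ m * G a x)"
      by (simp add: power_add algebra_simps)
    also have "\<dots> = w ^ m * (cpoly_eval (invs x) P + a * cpoly_eval (invs x) Q)
        + w ^ n * (cpoly_eval (invs x) R + a * cpoly_eval (invs x) S)"
      using F[OF x] G[OF x] by (simp add: w_def)
    finally show "(mom0 x * mom_det x) ^ (n + m) * (F a x + G a x)
      = cpoly_eval (invs x) (weight_poly ^ m * P + weight_poly ^ n * R)
        + a * cpoly_eval (invs x) (weight_poly ^ m * Q + weight_poly ^ n * S)"
      by (simp add: w_def cpoly_eval_weight algebra_simps)
  qed
qed

lemma frac_fun_mult:
  assumes "frac_fun F" "frac_fun G"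
  shows "frac_fun (\<lambda>a x. F a x * G a x)"
proof -
  obtain n P Q where F: "\<And>x a. x \<in> M30 \<Longrightarrow> a\<^sup>2 = mom0 x \<Longrightarrow> mom0 x \<noteq> 0 \<Longrightarrow> mom_det x \<noteq> 0 \<Longrightarrow>
     (mom0 x * mom_det x) ^ n * F a x = cpoly_eval (invs x) P + a * cpoly_eval (invs x) Q"
    using assms(1) unfolding frac_fun_def by blast
  obtain m R S where G: "\<And>x a. x \<in> M30 \<Longrightarrow> a\<^sup>2 = mom0 x \<Longrightarrow> mom0 x \<noteq> 0 \<Longrightarrow> mom_det x \<noteq> 0 \<Longrightarrow>
     (mom0 x * mom_det x) ^ m * G a x = cpoly_eval (invs x) R + a * cpoly_eval (invs x) S"
    using assms(2) unfolding frac_fun_def by blast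
  show ?thesis unfolding frac_fun_def
  proof (rule exI[of _ "n + m"], rule exI[of _ "P * R + Var 3 * (Q * S)"],
      rule exI[of _ "P * S + Q * R"], intro ballI allI impI)
    fix x a assume x: "x \<in> M30" "a\<^sup>2 = mom0 x" "mom0 x \<noteq> 0" "mom_det x \<noteq> 0"
    define w where "w = mom0 x * mom_det x"
    have "w ^ (n + m) * (F a x * G a x) = (w ^ n * F a x) * (w ^ m * G a x)"
      by (simp add: power_add)
    also have "\<dots> = (cpoly_eval (invs x) P + a * cpoly_eval (invs x) Q)
        * (cpoly_eval (invs x) R + a * cpoly_eval (invs x) S)"
      using F[OF x] G[OF x] by (simp add: w_def)
    also have "\<dots> = cpoly_eval (invs x) P * cpoly_eval (invs x) R
        + a\<^sup>2 * (cpoly_eval (invs x) Q * cpoly_eval (invs x) S)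
        + a * (cpoly_eval (invs x) P * cpoly_eval (invs x) S + cpoly_eval (invs x) Q * cpoly_eval (invs x) R)"
      by (simp add: algebra_simps power2_eq_square)
    finally show "(mom0 x * mom_det x) ^ (n + m) * (F a x * G a x)
      = cpoly_eval (invs x) (P * R + Var 3 * (Q * S)) + a * cpoly_eval (invs x) (P * S + Q * R)"
      using x(2) by (simp add: w_def invs_def)
  qed
qed

lemma frac_fun_diff:
  assumes "frac_fun F" "frac_fun G"
  shows "frac_fun (\<lambda>a x. F a x - G a x)"
  using frac_fun_add[OF assms(1) frac_fun_mult[OF frac_fun_const[of "- 1"] assms(2)]] by simp

lemma frac_fun_power: "frac_fun F \<Longrightarrow> frac_fun (\<lambda>a x. F a x ^ n)"
  by (induction n) (simp_all add: frac_fun_const frac_fun_mult)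

lemma frac_fun_divide_const: "frac_fun F \<Longrightarrow> frac_fun (\<lambda>a x. F a x / c)"
  using frac_fun_mult[OF _ frac_fun_const[of "1 / c"]] by simp

lemma frac_fun_divide_mom0:
  assumes "frac_fun F"
  shows "frac_fun (\<lambda>a x. F a x / mom0 x)"
proof -
  have "frac_fun (\<lambda>a x. 1 / mom0 x)" unfolding frac_fun_def
    by (rule exI[of _ 1], rule exI[of _ "Var 3 * Var 5 - (Var 4)\<^sup>2"], rule exI[of _ 0])
      (simp add: invs_def mom_det_def)
  from frac_fun_mult[OF assms this] show ?thesis by simp
qed

lemma frac_fun_divide_mom_det:
  assumes "frac_fun F"
  shows "frac_fun (\<lambda>a x. F a x / mom_det x)"
proof -
  have "frac_fun (\<lambda>a x. 1 / mom_det x)" unfolding frac_fun_def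
    by (rule exI[of _ 1], rule exI[of _ "Var 3"], rule exI[of _ 0]) (simp add: invs_def)
  from frac_fun_mult[OF assms this] show ?thesis by simp
qed

lemma frac_fun_mom_det: "frac_fun (\<lambda>a. mom_det)"
  unfolding mom_det_def[abs_def]
  by (intro frac_fun_diff frac_fun_mult frac_fun_power frac_fun_basic)

lemma frac_fun_cpoly_eval:
  fixes p :: "'v::finite cpoly"
  assumes "\<And>i. frac_fun (\<lambda>a x. e a x i)"
  shows "frac_fun (\<lambda>a x. cpoly_eval (e a x) p)"
  by (induction p rule: cpoly_induct)
    (simp_all add: assms frac_fun_const frac_fun_add frac_fun_mult)

text \<open>
  The coordinates, in the slice, of the representative of the orbit of \<open>x\<close> that belongs to the square
  root \<open>a\<close> of \<open>q0\<close>: in the notation of \<open>slice_exists\<close> they are \<open>\<alpha>\<close>, \<open>m\<close>, \<open>k\<close>, \<open>l\<close>, \<open>r\<close> and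
  \<open>z = (l - r) / (2 m\<^sup>2)\<close>, written with \<open>q0\<close> and \<open>H\<close> as the only denominators.
\<close>

definition nf_alpha :: "cmat3 \<Rightarrow> complex" where "nf_alpha x = mom1 x / mom0 x"
definition nf_mu :: "cmat3 \<Rightarrow> complex" where "nf_mu x = mom_det x / mom0 x / mom0 x / 4"
definition nf_prod :: "cmat3 \<Rightarrow> complex" where "nf_prod x = (tr2 x - 3 * (nf_alpha x)\<^sup>2 / 2 - 8 * nf_mu x) / 8"
definition nf_sum :: "cmat3 \<Rightarrow> complex" where
  "nf_sum x = (tr3 x / 3 - nf_alpha x ^ 3 / 4 + 4 * nf_alpha x * nf_prod x - 2 * nf_mu x * nf_alpha x) / 4"
definition nf_diff :: "complex \<Rightarrow> cmat3 \<Rightarrow> complex" where "nf_diff a x = \<i> * a * vol x / mom0 x / mom0 x / 4"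
definition nf_z :: "complex \<Rightarrow> cmat3 \<Rightarrow> complex" where
  "nf_z a x = (nf_sum x - nf_diff a x) * 8 * mom0 x ^ 4 / mom_det x / mom_det x"

definition normal_form :: "complex \<Rightarrow> cmat3 \<Rightarrow> cmat3" where
  "normal_form a x = slice a (nf_alpha x) (nf_mu x) ((nf_sum x + nf_diff a x) / 2) (nf_z a x)"

lemma frac_fun_normal_form: "frac_fun (\<lambda>a x. normal_form a x $ i $ j)"
proof -
  have 1: "frac_fun (\<lambda>a. nf_alpha)" unfolding nf_alpha_def[abs_def]
    by (intro frac_fun_divide_mom0 frac_fun_basic)
  have 2: "frac_fun (\<lambda>a. nf_mu)" unfolding nf_mu_def[abs_def]
    by (intro frac_fun_divide_const frac_fun_divide_mom0 frac_fun_mom_det)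
  have 3: "frac_fun (\<lambda>a. nf_prod)" unfolding nf_prod_def[abs_def]
    by (intro frac_fun_divide_const frac_fun_diff frac_fun_mult frac_fun_power frac_fun_const frac_fun_basic 1 2)
  have 4: "frac_fun (\<lambda>a. nf_sum)" unfolding nf_sum_def[abs_def]
    by (intro frac_fun_divide_const frac_fun_diff frac_fun_add frac_fun_mult frac_fun_power frac_fun_const
      frac_fun_basic 1 2 3)
  have 5: "frac_fun nf_diff" unfolding nf_diff_def[abs_def]
    by (intro frac_fun_divide_const frac_fun_divide_mom0 frac_fun_mult frac_fun_const frac_fun_root frac_fun_basic)
  have 6: "frac_fun nf_z" unfolding nf_z_def[abs_def]
    by (intro frac_fun_divide_mom_det frac_fun_mult frac_fun_diff frac_fun_power frac_fun_const frac_fun_basic 4 5)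
  have "\<forall>i j. frac_fun (\<lambda>a x. normal_form a x $ i $ j)"
    unfolding forall_3 normal_form_def slice_def gen_entries
    by (intro conjI frac_fun_diff frac_fun_add frac_fun_mult frac_fun_divide_const frac_fun_const frac_fun_root 
       1 2 4 5 6 frac_fun_diff[of "\<lambda>a x. 0", simplified])
  then show ?thesis by blast
qed

lemma normal_form_conj:
  assumes x: "x \<in> M30" "a\<^sup>2 = mom0 x" "mom0 x \<noteq> 0" "mom_det x \<noteq> 0"
  obtains g where "g \<in> SO3" "normal_form a x = g ** x ** transpose g"
proof -
  have nf: "normal_form a x = slice a (nf_alpha x) (nf_mu x) ((nf_sum x + nf_diff a x) / 2) ((nf_sum x - nf_diff a x) / (2 * (nf_mu x)\<^sup>2))"
    using x(3,4) by (simp add: normal_form_def nf_z_def nf_mu_def power_divide field_simps eval_nat_numeral)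
  note inv = slice_exists[OF vol_squared[OF x(1)] x(3) _ x(2), where \<alpha> = "nf_alpha x" and m = "nf_mu x"
      and k = "nf_prod x" and l = "nf_sum x" and r = "nf_diff a x" and x = "normal_form a x"]
  have "tr2 (normal_form a x) = tr2 x" "tr3 (normal_form a x) = tr3 x" "mom0 (normal_form a x) = mom0 x"
    "mom1 (normal_form a x) = mom1 x" "mom2 (normal_form a x) = mom2 x" "vol (normal_form a x) = vol x"
    by (rule inv; use x nf in \<open>simp add: mom_det_def nf_alpha_def nf_mu_def nf_prod_def nf_sum_def nf_diff_def power2_eq_square\<close>)+
  moreover have "normal_form a x \<in> M30" by (simp add: normal_form_def)
  ultimately show thesis
    using invariants_separate[OF x(1) _ _ _ _ _ _ _ x(4), of "normal_form a x"] that by metis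
qed

text \<open>
  The module generated by \<open>1\<close> and \<open>vol\<close> contains all invariant polynomial functions.
\<close>

lemma inv_span_invariant:
  assumes f: "polyfun f" and inv: "\<And>g x. g \<in> SO3 \<Longrightarrow> x \<in> M30 \<Longrightarrow> f (g ** x ** transpose g) = f x"
  shows "inv_span f"
proof -
  obtain p :: "(3 \<times> 3) cpoly" where p: "\<And>x. x \<in> M30 \<Longrightarrow> f x = cpoly_eval (\<lambda>(i, j). x $ i $ j) p"
    using f unfolding polyfun_def by blast
  have "frac_fun (\<lambda>a x. cpoly_eval (\<lambda>(i, j). normal_form a x $ i $ j) p)"
    by (rule frac_fun_cpoly_eval) (auto simp: frac_fun_normal_form split: prod.splits)
  then obtain n P Q where nPQ: "\<And>x a. x \<in> M30 \<Longrightarrow> a\<^sup>2 = mom0 x \<Longrightarrow> mom0 x \<noteq> 0 \<Longrightarrow> mom_det x \<noteq> 0 \<Longrightarrow>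
     (mom0 x * mom_det x) ^ n * cpoly_eval (\<lambda>(i, j). normal_form a x $ i $ j) p
       = cpoly_eval (invs x) P + a * cpoly_eval (invs x) Q"
    unfolding frac_fun_def by blast
  have nf: "(mom0 x * mom_det x) ^ n * f x = cpoly_eval (invs x) P + a * cpoly_eval (invs x) Q"
    if x: "x \<in> M30" "a\<^sup>2 = mom0 x" "mom0 x \<noteq> 0" "mom_det x \<noteq> 0" for x a
  proof -
    obtain g where g: "g \<in> SO3" "normal_form a x = g ** x ** transpose g"
      using normal_form_conj[OF x] by blast
    have "f x = f (normal_form a x)" using inv[OF g(1) x(1)] g(2) by simp
    also have "\<dots> = cpoly_eval (\<lambda>(i, j). normal_form a x $ i $ j) p"
      by (rule p) (simp add: normal_form_def)
    finally show ?thesis using nPQ[OF x] by simp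
  qed
  have eq: "(mom0 x * mom_det x) ^ Suc n * f x = cpoly_eval (invs x) (weight_poly * P)" if x: "x \<in> M30" for x
  proof (cases "mom0 x * mom_det x = 0")
    case False
    define a where "a = csqrt (mom0 x)"
    have a: "a\<^sup>2 = mom0 x" "(- a)\<^sup>2 = mom0 x" by (simp_all add: a_def)
    \<comment> \<open>Averaging over the two square roots of \<open>q0\<close> removes the part that is odd in \<open>a\<close>.\<close>
    have "2 * ((mom0 x * mom_det x) ^ n * f x) = 2 * cpoly_eval (invs x) P"
      using nf[OF x a(1)] nf[OF x a(2)] False by simp
    then show ?thesis by (simp add: cpoly_eval_weight mult.assoc)
  qed (auto simp: cpoly_eval_weight)
  have "inv_span (\<lambda>x. (mom0 x * mom_det x) ^ Suc n * f x)"
    using inv_span_cpoly_eval[of "weight_poly * P"] eq unfolding inv_span_def by simp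
  then show ?thesis by (rule inv_span_divide_power[OF f])
qed

text \<open>
  The elements \<open>1\<close> and \<open>vol\<close> are linearly independent over \<open>\<complex>[p2, p3, q0, q1, q2]\<close>, and the five even
  basic invariants are algebraically independent.
\<close>

lemma inv_span_zero:
  assumes zero: "\<And>x. x \<in> M30 \<Longrightarrow> inv_val A x + vol x * inv_val B x = 0"
  shows "val A p2 p3 q0 q1 q2 = 0" "val B p2 p3 q0 q1 q2 = 0"
proof -
  have van: "val A p2 p3 q0 q1 q2 = 0 \<and> gram_det p2 p3 q0 q1 q2 * val B p2 p3 q0 q1 q2 = 0"
    if nz: "q0 \<noteq> 0" "q0 * q2 - q1\<^sup>2 \<noteq> 0" for p2 p3 q0 q1 q2
  proof -
    note slice = slice_exists[OF _ nz _ refl refl refl refl refl refl, where d = "csqrt (gram_det p2 p3 q0 q1 q2)" and a = "csqrt q0"]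
    obtain x where x: "x \<in> M30" "tr2 x = p2" "tr3 x = p3" "mom0 x = q0" "mom1 x = q1" "mom2 x = q2"
      using slice by (metis power2_csqrt slice_M30)
    have "inv_val A x = 0" "inv_val gram_poly x * inv_val B x = 0"
      by (rule even_odd_vanish[of x "\<lambda>x. 0" A B]; use x zero in simp)+
    then show ?thesis by (simp add: inv_val_def x val_gram_poly)
  qed
  have wp: "val weight_poly p2 p3 q0 q1 q2 = q0 * (q0 * q2 - q1\<^sup>2)" for p2 p3 q0 q1 q2
    by (simp add: weight_poly_def)
  show "val A p2 p3 q0 q1 q2 = 0"
  proof (rule val_zero_generic[of weight_poly])
    show "val A p2 p3 q0 q1 q2 = 0" if "val weight_poly p2 p3 q0 q1 q2 \<noteq> 0" for p2 p3 q0 q1 q2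
      using that van[of q0 q2 q1] by (auto simp: wp)
    \<comment> \<open>At this point \<open>q0 H = 1\<close> and the Gram determinant is \<open>1\<close>, too.\<close>
    show "val weight_poly 4 0 1 0 1 \<noteq> 0" by (simp add: wp)
  qed
  show "val B p2 p3 q0 q1 q2 = 0"
  proof (rule val_zero_generic[of "weight_poly * gram_poly"])
    show "val B p2 p3 q0 q1 q2 = 0" if "val (weight_poly * gram_poly) p2 p3 q0 q1 q2 \<noteq> 0" for p2 p3 q0 q1 q2
      using that van[of q0 q2 q1] by (auto simp: wp val_gram_poly)
    show "val (weight_poly * gram_poly) 4 0 1 0 1 \<noteq> 0" by (simp add: wp val_gram_poly) (simp add: gram_det_def)
  qed
qed

section \<open>The invariants E1, ..., E6 and their relation\<close>

text \<open>
  The values of the six traces at a matrix.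
\<close>

definition Evals :: "cmat3 \<Rightarrow> 6 \<Rightarrow> complex" where
  "Evals x = point (E1 x) (E2 x) (E3 x) (E4 x) (E5 x) (E6 x)"

lemma SO3_transpose: "g \<in> SO3 \<Longrightarrow> transpose g ** g = mat 1"
  unfolding SO3_def using matrix_left_right_inverse[of g "transpose g"] by simp

lemma matrix_inv_SO3:
  assumes "g \<in> SO3"
  shows "matrix_inv g = transpose g"
proof -
  have 1: "g ** transpose g = mat 1" "transpose g ** g = mat 1"
    using assms SO3_transpose[OF assms] by (simp_all add: SO3_def)
  then have "\<exists>A'. g ** A' = mat 1 \<and> A' ** g = mat 1" by blast
  then have "matrix_inv g ** g = mat 1" unfolding matrix_inv_def by (rule someI2_ex) simp
  then have "matrix_inv g ** g ** transpose g = transpose g" by simp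
  then show ?thesis using 1 by (simp add: matrix_mul_assoc[symmetric])
qed

context
  fixes g :: cmat3
  assumes g: "g \<in> SO3"
begin

lemma conj_mult: "(g ** x ** transpose g) ** (g ** y ** transpose g) = g ** (x ** y) ** transpose g"
proof -
  have "(g ** x ** transpose g) ** (g ** y ** transpose g) = g ** x ** (transpose g ** g) ** y ** transpose g"
    by (simp add: matrix_mul_assoc)
  then show ?thesis by (simp add: SO3_transpose[OF g] matrix_mul_assoc)
qed

lemma trace_conj: "trace (g ** x ** transpose g) = trace x"
proof -
  have "trace (g ** x ** transpose g) = trace (transpose g ** (g ** x))" by (rule trace_mul_sym)
  then show ?thesis by (simp add: matrix_mul_assoc SO3_transpose[OF g])
qed

lemma transpose_conj: "transpose (g ** x ** transpose g) = g ** transpose x ** transpose g"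
  by (simp add: matrix_transpose_mul matrix_mul_assoc)

lemma conj_M30: "x \<in> M30 \<Longrightarrow> g ** x ** transpose g \<in> M30"
  by (simp add: M30_def trace_conj)

lemma Evals_conj: "x \<in> M30 \<Longrightarrow> Evals (g ** x ** transpose g) = Evals x"
  by (simp add: Evals_def E1_def E2_def E3_def E4_def E5_def E6_def conj_M30 conj_mult transpose_conj trace_conj)

end

text \<open>
  The polynomial identity behind the relation: the defining polynomial of the relation, times \<open>144\<close>, is
  \<open>9216 (d\<^sup>2 - D)\<close>. Here \<open>p2 = 2 P\<close> and \<open>p3 = 3 R\<close>, which clears the denominators.
\<close>

lemma Evals_relation_identity:
  fixes P R q0 q1 q2 d :: complex
  assumes "e1 = 2 * P - 2 * q0" "e2 = 2 * P + 2 * q0" "e3 = 3 * R + 3 * q1" "e4 = 3 * R - q1"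
    "e5 = 2 * P\<^sup>2 + 2 * q0\<^sup>2 + 4 * q2 - 4 * P * q0"
    "e6 = 8 * d + (P + q0) * e5 + 3 * R\<^sup>2 - 6 * R * q1 - q1\<^sup>2"
    "q3 = P * q1 + R * q0" "q4 = P * q2 + R * q1"
    "D = q0 * (q2 * q4 - q3\<^sup>2) - q1 * (q1 * q4 - q2 * q3) + q2 * (q1 * q3 - q2\<^sup>2)"
  shows "144 * e6\<^sup>2 + 48 * (e3\<^sup>2 - 3 * e2 * e5 - 3 * e4\<^sup>2) * e6 +
     (72 * e1^4 * e5 + 144 * e5 * (e1 * e3 * e4 + e5^2) + 16 * e3^2 * (e2^3 + e3^2)
     + 24 * e1^2 * e2 * e3 * (e3 + e4) - 3 * e1 * (e1^2 + e2^2) * (16 * e3 * e4 + 3 * e1^3)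
     + 36 * e1^2 * (e1 * e4^2 + e2^2 * e5 - 5 * e5^2) + 96 * e3 * e4^2 * (e4 - e3)
     + 144 * e4^2 * e5 * (e2 - e1) - 4 * e3^2 * (e1^3 + 24 * e2 * e5)) = 9216 * (d\<^sup>2 - D)"
  unfolding assms by Groebner_Basis.algebra

text \<open>
  The generator of the ideal of relations.
\<close>

definition rel_poly :: "6 cpoly" where
  "rel_poly = t6^2 + c1 * t6 + c2"

lemma Evals_relation:
  assumes x: "x \<in> M30"
  shows "cpoly_eval (Evals x) rel_poly = 0"
proof -
  define P where "P = tr2 x / 2"
  define R where "R = tr3 x / 3"
  have *: "tr2 x = 2 * P" "tr3 x = 3 * R" by (simp_all add: P_def R_def)
  define q3 where "q3 = P * mom1 x + R * mom0 x"
  define q4 where "q4 = P * mom2 x + R * mom1 x"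
  define D where "D = mom0 x * (mom2 x * q4 - q3\<^sup>2) - mom1 x * (mom1 x * q4 - mom2 x * q3) + mom2 x * (mom1 x * q3 - (mom2 x)\<^sup>2)"
  have D: "(vol x)\<^sup>2 = D"
    unfolding vol_squared[OF x] gram_det_def Let_def * D_def q3_def q4_def by simp
  have "2 * E5 x = 2 * (2 * P\<^sup>2 + 2 * (mom0 x)\<^sup>2 + 4 * mom2 x - 4 * P * mom0 x)"
    unfolding E5_eq[OF x] * by (simp add: algebra_simps power2_eq_square)
  then have e5: "E5 x = 2 * P\<^sup>2 + 2 * (mom0 x)\<^sup>2 + 4 * mom2 x - 4 * P * mom0 x"
    by (simp only: mult_cancel_left) simp
  have e: "E1 x = 2 * P - 2 * mom0 x" "E2 x = 2 * P + 2 * mom0 x" "E3 x = 3 * R + 3 * mom1 x" "E4 x = 3 * R - mom1 x"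
    using E1_eq[OF x] E2_eq[OF x] E3_eq[OF x] E4_eq[OF x] unfolding * by simp_all
  have "6 * E6 x = 6 * (8 * vol x + (P + mom0 x) * E5 x + 3 * R\<^sup>2 - 6 * R * mom1 x - (mom1 x)\<^sup>2)"
    unfolding E6_eq[OF x] e by (simp add: algebra_simps power2_eq_square)
  then have e6: "E6 x = 8 * vol x + (P + mom0 x) * E5 x + 3 * R\<^sup>2 - 6 * R * mom1 x - (mom1 x)\<^sup>2"
    by (simp only: mult_cancel_left) simp
  have "144 * cpoly_eval (Evals x) rel_poly = 9216 * ((vol x)\<^sup>2 - D)"
    unfolding Evals_relation_identity[OF e e5 e6 q3_def q4_def D_def, symmetric]
    by (simp add: rel_poly_def c1_def c2_def Evals_def algebra_simps)
  then show ?thesis by (simp add: D)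
qed

text \<open>
  The basic invariants are polynomials in the six traces.
\<close>

lemma inv_span_Evals:
  assumes "inv_span f"
  obtains Q where "\<And>x. x \<in> M30 \<Longrightarrow> f x = cpoly_eval (Evals x) Q"
proof -
  define p2 :: "6 cpoly" where "p2 = Const (1/2) * (t1 + t2)"
  define p3 :: "6 cpoly" where "p3 = Const (1/4) * (t3 + 3 * t4)"
  define q0 :: "6 cpoly" where "q0 = Const (1/4) * (t2 - t1)"
  define q1 :: "6 cpoly" where "q1 = Const (1/4) * (t3 - t4)"
  define q2 :: "6 cpoly" where "q2 = Const (1/8) * (2 * t5 - p2\<^sup>2 - 4 * q0\<^sup>2 + 4 * p2 * q0)"
  define vl :: "6 cpoly" where "vl = Const (1/48) * (6 * t6 + t3\<^sup>2 - 3 * t2 * t5 - 3 * t4\<^sup>2)"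
  obtain A B where AB: "\<And>x. x \<in> M30 \<Longrightarrow> f x = inv_val A x + vol x * inv_val B x"
    using assms unfolding inv_span_def by blast
  have ev: "cpoly_eval (Evals x) p2 = tr2 x" "cpoly_eval (Evals x) p3 = tr3 x" "cpoly_eval (Evals x) q0 = mom0 x"
    "cpoly_eval (Evals x) q1 = mom1 x" "cpoly_eval (Evals x) q2 = mom2 x" "cpoly_eval (Evals x) vl = vol x"
    if x: "x \<in> M30" for x
  proof -
    show 1: "cpoly_eval (Evals x) p2 = tr2 x" "cpoly_eval (Evals x) p3 = tr3 x" "cpoly_eval (Evals x) q0 = mom0 x"
     "cpoly_eval (Evals x) q1 = mom1 x"
      by (simp_all add: p2_def p3_def q0_def q1_def Evals_def E1_eq[OF x] E2_eq[OF x] E3_eq[OF x] E4_eq[OF x])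
    have "mom2 x = (2 * E5 x - (tr2 x)\<^sup>2 - 4 * (mom0 x)\<^sup>2 + 4 * tr2 x * mom0 x) / 8"
      unfolding E5_eq[OF x] by simp
    then show "cpoly_eval (Evals x) q2 = mom2 x"
      unfolding q2_def by (simp add: 1) (simp add: Evals_def)
    have "vol x = (6 * E6 x + (E3 x)\<^sup>2 - 3 * E2 x * E5 x - 3 * (E4 x)\<^sup>2) / 48"
      unfolding E6_eq[OF x] by simp
    then show "cpoly_eval (Evals x) vl = vol x"
      unfolding vl_def by (simp add: Evals_def)
  qed
  obtain A' where A': "\<And>u. cpoly_eval u A' = cpoly_eval (\<lambda>i. cpoly_eval u (point p2 p3 q0 q1 q2 0 i)) A"
    by (rule cpoly_subst[where s = "point p2 p3 q0 q1 q2 0" and p = A], rule that)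
  obtain B' where B': "\<And>u. cpoly_eval u B' = cpoly_eval (\<lambda>i. cpoly_eval u (point p2 p3 q0 q1 q2 0 i)) B"
    by (rule cpoly_subst[where s = "point p2 p3 q0 q1 q2 0" and p = B], rule that)
  show thesis
  proof (rule that[of "A' + vl * B'"])
    fix x assume x: "x \<in> M30"
    have "(\<lambda>i. cpoly_eval (Evals x) (point p2 p3 q0 q1 q2 0 i)) = point (tr2 x) (tr3 x) (mom0 x) (mom1 x) (mom2 x) 0"
      unfolding fun_eq_iff forall_6 by (simp add: ev[OF x])
    then show "f x = cpoly_eval (Evals x) (A' + vl * B')"
      by (simp add: A' B' ev[OF x] AB[OF x] inv_val_def val_def)
  qed
qed

text \<open>
  Polynomials in \<open>t\<^sub>1, ..., t\<^sub>5\<close>, characterised by their values.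
\<close>

definition free_of_t6 :: "6 cpoly \<Rightarrow> bool" where
  "free_of_t6 P \<longleftrightarrow> (\<forall>u c. cpoly_eval (u(6 := c)) P = cpoly_eval u P)"

lemma free_of_t6_intros:
  "free_of_t6 (Const c)" "free_of_t6 0" "free_of_t6 1" "free_of_t6 (numeral k)"
  "i \<noteq> 6 \<Longrightarrow> free_of_t6 (Var i)"
  "free_of_t6 P \<Longrightarrow> free_of_t6 Q \<Longrightarrow> free_of_t6 (P + Q)"
  "free_of_t6 P \<Longrightarrow> free_of_t6 Q \<Longrightarrow> free_of_t6 (P - Q)"
  "free_of_t6 P \<Longrightarrow> free_of_t6 Q \<Longrightarrow> free_of_t6 (P * Q)"
  "free_of_t6 P \<Longrightarrow> free_of_t6 (P ^ n)"
  by (simp_all add: free_of_t6_def)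

lemma free_of_t6_c: "free_of_t6 c1" "free_of_t6 c2"
  unfolding c1_def c2_def by (intro free_of_t6_intros; simp)+

text \<open>
  Division with remainder by the relation, which is monic of degree two in \<open>t\<^sub>6\<close>.
\<close>

lemma division_by_rel_poly:
  "\<exists>r A B. P = r * rel_poly + (A + B * t6) \<and> free_of_t6 A \<and> free_of_t6 B"
proof (induction P rule: cpoly_induct)
  case (Const c)
  show ?case
    by (rule exI[of _ 0], rule exI[of _ "Const c"], rule exI[of _ 0]) (simp add: free_of_t6_intros)
next
  case (Var i)
  show ?case
  proof (cases "i = 6")
    case True
    show ?thesis unfolding True
      by (rule exI[of _ 0], rule exI[of _ 0], rule exI[of _ 1]) (simp add: free_of_t6_intros)
  next
    case False
    then show ?thesis
      by - (rule exI[of _ 0], rule exI[of _ "Var i"], rule exI[of _ 0], simp add: free_of_t6_intros)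
  qed
next
  case (add P Q)
  then obtain r A B s C D where "P = r * rel_poly + (A + B * t6)" "free_of_t6 A" "free_of_t6 B"
    "Q = s * rel_poly + (C + D * t6)" "free_of_t6 C" "free_of_t6 D" by blast
  then show ?case
    by - (rule exI[of _ "r + s"], rule exI[of _ "A + C"], rule exI[of _ "B + D"],
        simp add: free_of_t6_intros algebra_simps)
next
  case (mult P Q)
  then obtain r A B s C D where P: "P = r * rel_poly + (A + B * t6)" "free_of_t6 A" "free_of_t6 B"
    and Q: "Q = s * rel_poly + (C + D * t6)" "free_of_t6 C" "free_of_t6 D" by blast
  have t6: "t6 * t6 = rel_poly - c1 * t6 - c2"
    by (simp add: rel_poly_def power2_eq_square)
  have "(A + B * t6) * (C + D * t6) = A * C + (A * D + B * C) * t6 + B * D * (t6 * t6)"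
    by (simp add: algebra_simps)
  also have "\<dots> = B * D * rel_poly + ((A * C - B * D * c2) + (A * D + B * C - B * D * c1) * t6)"
    unfolding t6 by (simp add: algebra_simps)
  finally have "P * Q = (r * Q + (A + B * t6) * s + B * D) * rel_poly
      + ((A * C - B * D * c2) + (A * D + B * C - B * D * c1) * t6)"
    unfolding P(1) Q(1) by (simp add: algebra_simps)
  moreover have "free_of_t6 (A * C - B * D * c2)" "free_of_t6 (A * D + B * C - B * D * c1)"
    using P Q by (simp_all add: free_of_t6_intros free_of_t6_c)
  ultimately show ?case by blast
qed

text \<open>
  A remainder that vanishes at the six traces is zero: substituting the basic invariants turns it into
  an element of the module generated by \<open>1\<close> and \<open>vol\<close>, where \<open>B\<close> becomes one eighth of the coefficient of
  \<open>vol\<close>; and the passage from \<open>p2, p3, q0, q1, q2\<close> to \<open>E1, ..., E5\<close> is surjective.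
\<close>

lemma remainder_zero:
  assumes A: "free_of_t6 A" and B: "free_of_t6 B"
    and zero: "\<And>x. x \<in> M30 \<Longrightarrow> cpoly_eval (Evals x) (A + B * t6) = 0"
  shows "A = 0" "B = 0"
proof -
  \<comment> \<open>The values of \<open>E1, ..., E5\<close> as polynomials in the basic invariants, and \<open>G = E6 - 8 vol\<close>.\<close>
  define T :: "6 \<Rightarrow> 6 cpoly" where
    "T = point (Var 1 - 2 * Var 3) (Var 1 + 2 * Var 3) (Var 2 + 3 * Var 4) (Var 2 - Var 4)
       (Const (1/2) * ((Var 1)\<^sup>2 + 4 * (Var 3)\<^sup>2 + 8 * Var 5 - 4 * Var 1 * Var 3)) 0"
  define G :: "6 cpoly" where "G = Const (1/6) * (3 * T 2 * T 5 + 3 * (T 4)\<^sup>2 - (T 3)\<^sup>2)"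
  have T: "(\<lambda>i. cpoly_eval (point (tr2 x) (tr3 x) (mom0 x) (mom1 x) (mom2 x) 0) (T i)) = (Evals x)(6 := 0)"
    if x: "x \<in> M30" for x
  proof -
    have "E5 x = ((tr2 x)\<^sup>2 + 4 * (mom0 x)\<^sup>2 + 8 * mom2 x - 4 * tr2 x * mom0 x) / 2"
      unfolding E5_eq[OF x, symmetric] by simp
    then show ?thesis
      unfolding fun_eq_iff forall_6
      by (simp add: T_def Evals_def E1_eq[OF x] E2_eq[OF x] E3_eq[OF x] E4_eq[OF x])
  qed
  obtain A' where A': "\<And>u. cpoly_eval u A' = cpoly_eval (\<lambda>i. cpoly_eval u (T i)) A"
    by (rule cpoly_subst[where s = T and p = A], rule that)
  obtain B' where B': "\<And>u. cpoly_eval u B' = cpoly_eval (\<lambda>i. cpoly_eval u (T i)) B"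
    by (rule cpoly_subst[where s = T and p = B], rule that)
  have iA: "inv_val A' x = cpoly_eval (Evals x) A" and iB: "inv_val B' x = cpoly_eval (Evals x) B"
    and iG: "inv_val G x = E6 x - 8 * vol x" if x: "x \<in> M30" for x
  proof -
    show "inv_val A' x = cpoly_eval (Evals x) A" "inv_val B' x = cpoly_eval (Evals x) B"
      using A B by (simp_all add: inv_val_def val_def A' B' T[OF x] free_of_t6_def)
    have t: "inv_val (T i) x = ((Evals x)(6 := 0)) i" for i
      using fun_cong[OF T[OF x], of i] by (simp add: inv_val_def val_def)
    have "inv_val G x = (3 * inv_val (T 2) x * inv_val (T 5) x + 3 * (inv_val (T 4) x)\<^sup>2 - (inv_val (T 3) x)\<^sup>2) / 6"
      by (simp add: G_def inv_val_def)
    also have "\<dots> = (3 * E2 x * E5 x + 3 * (E4 x)\<^sup>2 - (E3 x)\<^sup>2) / 6"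
      unfolding t by (simp add: Evals_def)
    also have "\<dots> = E6 x - 8 * vol x"
      using E6_eq[OF x] by (simp add: field_simps)
    finally show "inv_val G x = E6 x - 8 * vol x" .
  qed
  have "inv_val (A' + B' * G) x + vol x * inv_val (Const 8 * B') x = 0" if x: "x \<in> M30" for x
    using zero[OF x] by (simp add: iA[OF x] iB[OF x] iG[OF x] algebra_simps Evals_def)
  note z = inv_span_zero[OF this]
  have B'0: "val B' p2 p3 q0 q1 q2 = 0" for p2 p3 q0 q1 q2
    using z(2)[of p2 p3 q0 q1 q2] by simp
  have A'0: "val A' p2 p3 q0 q1 q2 = 0" for p2 p3 q0 q1 q2
    using z(1)[of p2 p3 q0 q1 q2] by (simp add: B'0)
  have surj: "\<exists>p2 p3 q0 q1 q2. (\<lambda>i. cpoly_eval (point p2 p3 q0 q1 q2 0) (T i)) = u(6 := 0)" for u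
  proof -
    define p2 where "p2 = (u 1 + u 2) / 2"
    define q0 where "q0 = (u 2 - u 1) / 4"
    have "(\<lambda>i. cpoly_eval (point p2 ((u 3 + 3 * u 4) / 4) q0 ((u 3 - u 4) / 4)
        ((2 * u 5 - p2\<^sup>2 - 4 * q0\<^sup>2 + 4 * p2 * q0) / 8) 0) (T i)) = u(6 := 0)"
      unfolding fun_eq_iff forall_6
      by (simp add: T_def) (simp add: p2_def q0_def field_simps)
    then show ?thesis by blast
  qed
  have "cpoly_eval u A = 0" "cpoly_eval u B = 0" for u
  proof -
    obtain p2 p3 q0 q1 q2 where *: "(\<lambda>i. cpoly_eval (point p2 p3 q0 q1 q2 0) (T i)) = u(6 := 0)"
      using surj by blast
    show "cpoly_eval u A = 0"
      using A A'0[of p2 p3 q0 q1 q2] unfolding val_def A' * free_of_t6_def by simp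
    show "cpoly_eval u B = 0"
      using B B'0[of p2 p3 q0 q1 q2] unfolding val_def B' * free_of_t6_def by simp
  qed
  then show "A = 0" "B = 0" by (auto intro: cpoly_eval_injective)
qed

lemma Evals_kernel:
  assumes "\<And>x. x \<in> M30 \<Longrightarrow> cpoly_eval (Evals x) P = 0"
  obtains r where "P = r * rel_poly"
proof -
  obtain r A B where P: "P = r * rel_poly + (A + B * t6)" and AB: "free_of_t6 A" "free_of_t6 B"
    using division_by_rel_poly by blast
  have "cpoly_eval (Evals x) (A + B * t6) = 0" if x: "x \<in> M30" for x
    using assms[OF x] unfolding P by (simp add: Evals_relation[OF x])
  from remainder_zero[OF AB this] have "P = r * rel_poly" using P by simp
  with that show thesis .
qed

section \<open>The presentation of the algebra of invariants\<close>

lemma S3_carrier: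
  "f \<in> carrier S3 \<longleftrightarrow> f \<in> extensional M30 \<and> polyfun f
     \<and> (\<forall>g\<in>SO3. \<forall>x\<in>M30. f (g ** x ** transpose g) = f x)"
  by (auto simp: S3_def poly_funs_def polyfun_def matrix_inv_SO3)

lemma restrict_in_S3:
  assumes "polyfun f" "\<And>g x. g \<in> SO3 \<Longrightarrow> x \<in> M30 \<Longrightarrow> f (g ** x ** transpose g) = f x"
  shows "restrict f M30 \<in> carrier S3"
  using assms by (simp add: S3_carrier conj_M30 polyfun_def)

lemma ring_S3: "ring S3"
proof -
  have closed: "(\<lambda>x\<in>M30. f x + g x) \<in> carrier S3" "(\<lambda>x\<in>M30. f x * g x) \<in> carrier S3"
    if "f \<in> carrier S3" "g \<in> carrier S3" for f g
    by (intro restrict_in_S3 polyfun_add polyfun_mult; use that in \<open>simp add: S3_carrier\<close>)+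
  have const: "(\<lambda>x\<in>M30. c) \<in> carrier S3" for c
    by (rule restrict_in_S3) (simp_all add: polyfun_const)
  have neg: "(\<lambda>x\<in>M30. - f x) \<in> carrier S3" if "f \<in> carrier S3" for f
    by (intro restrict_in_S3 polyfun_uminus; use that in \<open>simp add: S3_carrier\<close>)
  have ext: "(\<lambda>x\<in>M30. f x) = f" if "f \<in> carrier S3" for f
    using that by (simp add: S3_carrier extensional_restrict)
  have ops: "f \<otimes>\<^bsub>S3\<^esub> g = (\<lambda>x\<in>M30. f x * g x)" "f \<oplus>\<^bsub>S3\<^esub> g = (\<lambda>x\<in>M30. f x + g x)"
    "\<one>\<^bsub>S3\<^esub> = (\<lambda>x\<in>M30. 1)" "\<zero>\<^bsub>S3\<^esub> = (\<lambda>x\<in>M30. 0)" for f g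
    by (simp_all add: S3_def)
  have cong: "restrict f M30 = restrict g M30" if "\<And>x. x \<in> M30 \<Longrightarrow> f x = g x" for f g :: "cmat3 \<Rightarrow> complex"
    using that by (auto simp: restrict_def)
  show ?thesis
  proof (rule ringI)
    show "abelian_group S3"
    proof (rule abelian_groupI)
      show "\<exists>g\<in>carrier S3. g \<oplus>\<^bsub>S3\<^esub> f = \<zero>\<^bsub>S3\<^esub>" if "f \<in> carrier S3" for f
        using neg[OF that] by (intro bexI[of _ "\<lambda>x\<in>M30. - f x"]) (auto simp: ops intro!: cong)
      show "\<zero>\<^bsub>S3\<^esub> \<oplus>\<^bsub>S3\<^esub> f = f" if "f \<in> carrier S3" for f
      proof -
        have "\<zero>\<^bsub>S3\<^esub> \<oplus>\<^bsub>S3\<^esub> f = (\<lambda>x\<in>M30. f x)" by (auto simp: ops intro!: cong)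
        then show ?thesis using ext[OF that] by simp
      qed
    qed (auto simp: ops closed const algebra_simps intro!: cong)
    show "monoid S3"
    proof (rule monoidI)
      fix f assume f: "f \<in> carrier S3"
      have "\<one>\<^bsub>S3\<^esub> \<otimes>\<^bsub>S3\<^esub> f = (\<lambda>x\<in>M30. f x)" "f \<otimes>\<^bsub>S3\<^esub> \<one>\<^bsub>S3\<^esub> = (\<lambda>x\<in>M30. f x)"
        by (auto simp: ops intro!: cong)
      then show "\<one>\<^bsub>S3\<^esub> \<otimes>\<^bsub>S3\<^esub> f = f" "f \<otimes>\<^bsub>S3\<^esub> \<one>\<^bsub>S3\<^esub> = f" using ext[OF f] by simp_all
    qed (auto simp: ops closed const algebra_simps intro!: cong)
  qed (auto simp: ops algebra_simps intro!: cong)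
qed

text \<open>
  Substitution of the six traces for the variables.
\<close>

definition eval_hom :: "6 cpoly \<Rightarrow> cmat3 \<Rightarrow> complex" where
  "eval_hom P = (\<lambda>x\<in>M30. cpoly_eval (Evals x) P)"

lemma polyfun_cong: "(\<And>x. x \<in> M30 \<Longrightarrow> f x = g x) \<Longrightarrow> polyfun f \<longleftrightarrow> polyfun g"
  by (simp add: polyfun_def)

lemma polyfun_trace:
  fixes A :: "cmat3 \<Rightarrow> cmat3"
  assumes "\<And>i j. polyfun (\<lambda>x. A x $ i $ j)"
  shows "polyfun (\<lambda>x. trace (A x))"
  unfolding trace_def sum_3 by (intro polyfun_add assms)

lemma polyfun_matrix_mult:
  fixes A B :: "cmat3 \<Rightarrow> cmat3"
  assumes "\<And>i j. polyfun (\<lambda>x. A x $ i $ j)" "\<And>i j. polyfun (\<lambda>x. B x $ i $ j)"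
  shows "polyfun (\<lambda>x. (A x ** B x) $ i $ j)"
  unfolding matrix_matrix_mult_def sum_3 vec_lambda_beta by (intro polyfun_add polyfun_mult assms)

lemma polyfun_transpose: "polyfun (\<lambda>x. transpose x $ i $ j)"
  unfolding transpose_def vec_lambda_beta by (rule polyfun_entry)

lemma polyfun_Evals: "polyfun (\<lambda>x. Evals x i)"
proof -
  note intros = polyfun_trace polyfun_matrix_mult polyfun_transpose polyfun_entry
  have "polyfun E1" "polyfun E2" "polyfun E3" "polyfun E4" "polyfun E5" "polyfun E6"
    unfolding E1_def E2_def E3_def E4_def E5_def E6_def
    by (subst polyfun_cong[OF restrict_apply'], assumption, intro intros)+
  then have "\<forall>i. polyfun (\<lambda>x. Evals x i)"
    unfolding forall_6 Evals_def point_simps by simp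
  then show ?thesis ..
qed

lemma eval_hom_in_S3: "eval_hom P \<in> carrier S3"
  unfolding eval_hom_def
  by (rule restrict_in_S3) (auto simp: Evals_conj intro: polyfun_cpoly_eval polyfun_Evals)

lemma ring_hom_eval: "ring_hom_ring Ct S3 eval_hom"
proof (rule ring_hom_ringI)
  show "ring Ct" unfolding Ct_def by (rule ring_from_type_algebra)
  show "ring S3" by (rule ring_S3)
  show "eval_hom P \<in> carrier S3" for P by (rule eval_hom_in_S3)
qed (auto simp: Ct_def ring_of_type_algebra_def S3_def eval_hom_def restrict_def)

lemma eval_hom_surj: "eval_hom ` carrier Ct = carrier S3"
proof
  show "eval_hom ` carrier Ct \<subseteq> carrier S3" using eval_hom_in_S3 by blast
  show "carrier S3 \<subseteq> eval_hom ` carrier Ct"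
  proof
    fix f assume f: "f \<in> carrier S3"
    then have span: "inv_span f" by (intro inv_span_invariant) (simp_all add: S3_carrier)
    obtain Q where Q: "\<And>x. x \<in> M30 \<Longrightarrow> f x = cpoly_eval (Evals x) Q"
      by (rule inv_span_Evals[OF span], rule that)
    have "f = eval_hom Q"
    proof (rule extensionalityI)
      show "f \<in> extensional M30" using f by (simp add: S3_carrier)
    qed (simp_all add: eval_hom_def Q)
    then show "f \<in> eval_hom ` carrier Ct" by (simp add: Ct_def ring_of_type_algebra_def)
  qed
qed

lemma eval_hom_kernel: "a_kernel Ct S3 eval_hom = relation_ideal"
proof -
  have "relation_ideal = {r * rel_poly | r. True}"
    by (simp add: relation_ideal_def cgenideal_def Ct_def ring_of_type_algebra_def rel_poly_def)
  also have "\<dots> = {P. \<forall>x\<in>M30. cpoly_eval (Evals x) P = 0}"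
  proof (intro equalityI subsetI)
    fix P assume "P \<in> {P. \<forall>x\<in>M30. cpoly_eval (Evals x) P = 0}"
    then obtain r where "P = r * rel_poly" using Evals_kernel[of P] by blast
    then show "P \<in> {r * rel_poly | r. True}" by blast
  qed (auto simp: Evals_relation)
  also have "\<dots> = a_kernel Ct S3 eval_hom"
    by (auto simp: a_kernel_def' Ct_def ring_of_type_algebra_def S3_def eval_hom_def restrict_def fun_eq_iff)
  finally show ?thesis ..
qed

lemma eval_hom_Const: "eval_hom (Const c) = (\<lambda>x\<in>M30. c)"
  by (simp add: eval_hom_def)

lemma eval_hom_Var:
  "eval_hom t1 = E1" "eval_hom t2 = E2" "eval_hom t3 = E3"
  "eval_hom t4 = E4" "eval_hom t5 = E5" "eval_hom t6 = E6"
  unfolding eval_hom_def Evals_def cpoly_eval_Var point_simps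
  by (simp_all add: E1_def E2_def E3_def E4_def E5_def E6_def cong: restrict_cong)

theorem corollary2p4:
  shows "\<exists>\<phi> \<in> ring_iso (Ct Quot relation_ideal) S3.
           (\<forall>c. \<phi> (quot_class (Const c)) = (\<lambda>x\<in>M30. c)) \<and>
           \<phi> (quot_class t1) = E1 \<and>
           \<phi> (quot_class t2) = E2 \<and>
           \<phi> (quot_class t3) = E3 \<and>
           \<phi> (quot_class t4) = E4 \<and>
           \<phi> (quot_class t5) = E5 \<and>
           \<phi> (quot_class t6) = E6"
proof -
  interpret ring_hom_ring Ct S3 eval_hom by (rule ring_hom_eval)
  define \<phi> where "\<phi> K = the_elem (eval_hom ` K)" for K
  have "\<phi> \<in> ring_iso (Ct Quot relation_ideal) S3"
    using FactRing_iso_set[OF eval_hom_surj] by (simp add: \<phi>_def[abs_def] eval_hom_kernel)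
  moreover have "\<phi> (quot_class P) = eval_hom P" for P
  proof -
    have "P \<in> carrier Ct" by (simp add: Ct_def ring_of_type_algebra_def)
    from the_elem_simp[OF this] show ?thesis
      by (simp only: \<phi>_def quot_class_def eval_hom_kernel)
  qed
  ultimately show ?thesis
    by (intro bexI[of _ \<phi>]) (simp_all add: eval_hom_Const eval_hom_Var)
qed

end
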